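(* Let $0\le n\le N-1$ and let $(\boldsymbol{u}_h^{n+1},\boldsymbol{p}_h^{n+1},z_h^{n+1},\boldsymbol{p}_h^{p,n+1})\in\boldsymbol{X}_h$ be the solution at time level $t^{n+1}$ of the fully-discrete HDG method (F) described in the context. Then the following hold: $$\begin{aligned} \text{(a)}\quad & [\![ u_h^{j,n+1}\cdot n ]\!]=0 && \text{on every facet } F\in\mathcal{F}_{int}^j\cup\mathcal{F}_D^j,\ j=s,b,\\ \text{(b)}\quad & u_h^{j,n+1}\cdot n=\bar u_h^{j,n+1}\cdot n && \text{on every facet } F\in\mathcal{F}_N^j\cup\mathcal{F}_I,\ j=s,b,\\ \text{(c)}\quad & [\![ z_h^{n+1}\cdot n ]\!]=0 && \text{on every facet } F\in\mathcal{F}_{int}^b\cup\mathcal{F}_F^b,\\ \text{(d)}\quad & u_h^{s,n+1}\cdot n=(z_h^{n+1}+d_tu_h^{b,n+1})\cdot n && \text{on every facet } F\in\mathcal{F}_I,\\ \text{(e)}\quad & \nabla\cdot u_h^{s,n+1}=0 && \text{pointwise on every } K\in\mathcal{T}^s,\\ \text{(f)}\quad & \nabla\cdot u_h^{b,n+1}=\lambda^{-1}(\alpha p_h^{p,n+1}-p_h^{b,n+1}) && \text{pointwise on every } K\in\mathcal{T}^b,\\ \text{(g)}\quad & \nabla\cdot z_h^{n+1}=\Pi_Q^b g^{b,n+1}-c_0d_tp_h^{p,n+1}-\alpha\lambda^{-1}(\alpha d_tp_h^{p,n+1}-d_tp_h^{b,n+1}) && \text{pointwise on every } K\in\mathcal{T}^b,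 \end{aligned}$$ where $\Pi_Q^b$ is the $L^2$-projection onto $Q_h^b$ and $[\![\cdot]\!]$ is the usual jump operator.
   Context: **Domain and parameters.** $\Omega\subset\mathbb{R}^d$ ($d=2,3$) is a polygonal/polyhedral domain partitioned into two non-overlapping subdomains $\Omega^s$ and $\Omega^b$ with polygonal interface $\Gamma_I=\partial\Omega^s\cap\partial\Omega^b$. $n^j$ is the unit outward normal to $\Omega^j$ (also used for the outward normal on element boundaries of $\mathcal{T}^j$), and $n=n^s=-n^b$ on $\Gamma_I$. $\Gamma^b=\partial\Omega\cap\partial\Omega^b$ is partitioned both as $\Gamma_P^b\cup\Gamma_F^b$ (disjoint, $|\Gamma_P^b|>0$) and as $\Gamma_D^b\cup\Gamma_N^b$ (disjoint, both of positive measure); $\Gamma^s=\partial\Omega\cap\partial\Omega^s=\Gamma_D^s\cup\Gamma_N^s$ (disjoint, both of positive measure). Constants: $\mu^s,\mu^b,\lambda,\kappa,\gamma>0$, $0<\alpha<1$, $c_0\ge0$. Data: $f^j:\Omega^j\to\mathbb{R}^d$ ($j=s,b$; $f|_{\Omega^j}=f^j$), $g^b:\Omega^b\to\mathbb{R}$, depending on time. $(w)^t:=w-(w\cdot n)n$ and $\varepsilon(u)=\tfrac12(\nabla u+(\nabla u)^T)$. **Mesh.** $\mathcal{T}^j$ is a shape-regular triangulation of $\Omega^j$ ($j=s,b$), with $\mathcal{T}^s$ and $\mathcal{T}^b$ matching at $\Gamma_I$; $\mathcal{T}=\mathcal{T}^s\cup\mathcal{T}^b$; $h_K$ is the diameter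 of $K$. $\mathcal{F}^j$ is the set of facets in $\overline{\Omega^j}$, $\mathcal{F}^j_{int}$ those in the interior of $\Omega^j$, and $\mathcal{F}_I,\mathcal{F}_D^j,\mathcal{F}_N^j,\mathcal{F}_F^b,\mathcal{F}_P^b$ those on $\Gamma_I,\Gamma_D^j,\Gamma_N^j,\Gamma_F^b,\Gamma_P^b$; $\Gamma_0^j=\cup_{F\in\mathcal{F}^j}F$. On an interior facet the jump of a normal component is the sum over the two adjacent elements of the trace dotted with the respective outward normal; on a boundary facet it is the trace dotted with the outward normal. **Spaces** (polynomial degree $k\ge1$). $V_h^j$, $V_h$: functions in $[L^2]^d$ on $\Omega^j$, $\Omega$ that are in $[P_k(K)]^d$ on each element; $Q_h^j$, $Q_h$: functions in $L^2$ on $\Omega^j$, $\Omega$ that are in $P_{k-1}(K)$ on each element. $\bar V_h^j$: functions in $[L^2(\Gamma_0^j)]^d$ that are in $[P_k(F)]^d$ on each $F\in\mathcal{F}^j$ and vanish on $\Gamma_D^j$. $\bar Q_h^j$: functions in $L^2(\Gamma_0^j)$ that are in $P_k(F)$ on each $F\in\mathcal{F}^j$. $\bar Q_h^{b0}=\{\bar q\in\bar Q_h^b:\bar q=0\text{ on }\Gamma_P^b\}$. Put $\boldsymbol{v}_h=(v_h,\bar v_h^s,\bar v_h^b)\in\boldsymbol{V}_h=V_h\times\bar V_h^s\times\bar V_h^b$, $\boldsymbol{q}_h=(q_h,\bar q_h^s,\bar q_h^b)\in\boldsymbol{Q}_h=Q_h\times\bar Q_h^s\times\bar Q_h^b$,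 $\boldsymbol{q}_h^p=(q_h^p,\bar q_h^p)\in\boldsymbol{Q}_h^{b0}=Q_h^b\times\bar Q_h^{b0}$, $\boldsymbol{X}_h=\boldsymbol{V}_h\times\boldsymbol{Q}_h\times V_h^b\times\boldsymbol{Q}_h^{b0}$, and for $j=s,b$: $v_h^j=v_h|_{\Omega^j}$, $q_h^j=q_h|_{\Omega^j}$, $\boldsymbol{v}_h^j=(v_h^j,\bar v_h^j)$, $\boldsymbol{q}_h^j=(q_h^j,\bar q_h^j)$. **Forms** ($(\cdot,\cdot)_{\Omega^j}$ is the elementwise $L^2$ inner product, $\langle\cdot,\cdot\rangle_{\partial\mathcal{T}^j}=\sum_{K\in\mathcal{T}^j}\langle\cdot,\cdot\rangle_{\partial K}$, $\beta^j>0$ is a penalty parameter): $a_h^j(\boldsymbol{u}^j,\boldsymbol{v}^j)=(2\mu^j\varepsilon(u),\varepsilon(v))_{\Omega^j}+\sum_{K\in\mathcal{T}^j}\langle2\beta^j\mu^jh_K^{-1}(u-\bar u^j),v-\bar v^j\rangle_{\partial K}-\langle2\mu^j\varepsilon(u)n^j,v-\bar v^j\rangle_{\partial\mathcal{T}^j}-\langle2\mu^j\varepsilon(v)n^j,u-\bar u^j\rangle_{\partial\mathcal{T}^j}$; $a_h=a_h^s+a_h^b$; $b_h^j(\boldsymbol{q}^j,\boldsymbol{v}^j)=-(q,\nabla\cdot v)_{\Omega^j}+\langle\bar q^j,(v-\bar v^j)\cdot n^j\rangle_{\partial\mathcal{T}^j}$; $b_h=b_h^s+b_h^b$; $c_h((p,r),q)=(\lambda^{-1}(\alpha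 p-r),q)_{\Omega^b}$; $a_h^I((\bar u^s,\bar u^b),(\bar v^s,\bar v^b))=\langle\gamma(\mu^s/\kappa)^{1/2}(\bar u^s-\bar u^b)^t,(\bar v^s-\bar v^b)^t\rangle_{\Gamma_I}$; $b_h^I(\bar q^p,(\bar v^s,\bar v^b))=\langle\bar q^p,(\bar v^s-\bar v^b)\cdot n\rangle_{\Gamma_I}$. **Fully-discrete method (F).** With $t^n=n\Delta t$, $n=0,\dots,N$, $t^N=T$, $\Delta t>0$, $d_tg^{n+1}=(g^{n+1}-g^n)/\Delta t$, and a superscript $n$ denoting evaluation at $t^n$: given the level-$n$ quantities (initial data for $n=0$), find $(\boldsymbol{u}_h^{n+1},\boldsymbol{p}_h^{n+1},z_h^{n+1},\boldsymbol{p}_h^{p,n+1})\in\boldsymbol{X}_h$ such that for all $(\boldsymbol{v}_h,\boldsymbol{q}_h,w_h,\boldsymbol{q}_h^p)\in\boldsymbol{X}_h$ $a_h(\boldsymbol{u}_h^{n+1},\boldsymbol{v}_h)+a_h^I((\bar u_h^{s,n+1},d_t\bar u_h^{b,n+1}),(\bar v_h^s,\bar v_h^b))+b_h(\boldsymbol{p}_h^{n+1},\boldsymbol{v}_h)+b_h^I(\bar p_h^{p,n+1},(\bar v_h^s,\bar v_h^b))=(f^{n+1},v_h)_\Omega$, $b_h(\boldsymbol{q}_h,\boldsymbol{u}_h^{n+1})+c_h((p_h^{p,n+1},p_h^{b,n+1}),q_h^b)=0$, $(c_0d_tp_h^{p,n+1},q_h^p)_{\Omega^b}+c_h((d_tp_h^{p,n+1},d_tp_h^{b,n+1}),\alpha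 q_h^p)-b_h^b(\boldsymbol{q}_h^p,(z_h^{n+1},0))-b_h^I(\bar q_h^p,(\bar u_h^{s,n+1},d_t\bar u_h^{b,n+1}))=(g^{b,n+1},q_h^p)_{\Omega^b}$, $(\kappa^{-1}z_h^{n+1},w_h)_{\Omega^b}+b_h^b(\boldsymbol{p}_h^{p,n+1},(w_h,0))=0$.
   Formalization: Part (d) at n = 0 additionally assumes that the initial data satisfy u_h^{b,0}·n = ū_h^{b,0}·n on the interface facets; since u_h^{b,0} does not enter (F), (d) fails at n = 0 without this. *)

theory Defs
  imports "HOL-Analysis.Analysis"
begin

section \<open>Polynomial spaces and differential operators\<close>

definition polys :: "nat \<Rightarrow> (real^'n \<Rightarrow> real) set" where
  "polys k = {p. \<exists>c :: ('n \<Rightarrow> nat) \<Rightarrow> real. \<forall>x.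
      p x = (\<Sum>a | (\<Sum>i\<in>UNIV. a i) \<le> k. c a * (\<Prod>i\<in>UNIV. (x $ i) ^ a i))}"

definition vpolys :: "nat \<Rightarrow> (real^'n \<Rightarrow> real^'n) set" where
  "vpolys k = {v. \<forall>i. (\<lambda>x. v x $ i) \<in> polys k}"

definition grad :: "(real^'n \<Rightarrow> real^'n) \<Rightarrow> real^'n \<Rightarrow> real^'n^'n" where
  "grad v x = jacobian v (at x)"

definition sym_grad :: "(real^'n \<Rightarrow> real^'n) \<Rightarrow> real^'n \<Rightarrow> real^'n^'n" where
  "sym_grad v x = (1/2) *\<^sub>R (grad v x + transpose (grad v x))"

definition divergence :: "(real^'n \<Rightarrow> real^'n) \<Rightarrow> real^'n \<Rightarrow> real" where
  "divergence v x = trace (grad v x)"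

definition tangential :: "real^'n \<Rightarrow> real^'n \<Rightarrow> real^'n" where
  "tangential n w = w - (w \<bullet> n) *\<^sub>R n"

definition square_integrable_on :: "(real^'n \<Rightarrow> 'b::euclidean_space) \<Rightarrow> (real^'n) set \<Rightarrow> bool"
    (infixr "square'_integrable'_on" 46) where
  "f square_integrable_on S \<longleftrightarrow>
     set_borel_measurable lebesgue S f \<and> set_integrable lebesgue S (\<lambda>x. (norm (f x))\<^sup>2)"


section \<open>Polyhedral domains, meshes, facets\<close>

text \<open>Regularity (\<open>interior (closure S) = S\<close>) excludes slits. Connectedness is not part of this
  notion.\<close>

definition polyhedral_open :: "(real^'n) set \<Rightarrow> bool" where
  "polyhedral_open S \<longleftrightarrow> S \<noteq> {} \<and> interior (closure S) = S \<and>
     (\<exists>\<P>. finite \<P> \<and> (\<forall>P\<in>\<P>. polytope P) \<and> closure S = \<Union>\<P>)"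

definition simplicial_mesh :: "(real^'n) set set \<Rightarrow> (real^'n) set \<Rightarrow> bool" where
  "simplicial_mesh M S \<longleftrightarrow>
     triangulation M \<and> (\<forall>K\<in>M. int CARD('n) simplex K) \<and> \<Union>M = closure S"

definition shape_regular :: "real \<Rightarrow> (real^'n) set set \<Rightarrow> bool" where
  "shape_regular \<sigma> M \<longleftrightarrow>
     (\<forall>K\<in>M. diameter K \<le> \<sigma> * Sup {2 * r | r x. 0 \<le> r \<and> cball x r \<subseteq> K})"

definition facets :: "(real^'n) set set \<Rightarrow> (real^'n) set set" where
  "facets M = {F. \<exists>K\<in>M. F facet_of K}"

text \<open>Relative interiors are used because the (closed) facets on, say, the Dirichlet part of the
  boundary may have their own boundary points in the Neumann part. With \<open>\<Gamma>\<close> an open set this gives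
  the facets interior to that set.\<close>

definition facets_on :: "(real^'n) set set \<Rightarrow> (real^'n) set \<Rightarrow> (real^'n) set set" where
  "facets_on M \<Gamma> = {F \<in> facets M. rel_interior F \<subseteq> \<Gamma>}"

definition outward_normal :: "(real^'n) set \<Rightarrow> (real^'n) set \<Rightarrow> real^'n" where
  "outward_normal K F = (THE n. norm n = 1 \<and> (\<forall>x\<in>K. \<forall>y\<in>F. n \<bullet> (x - y) \<le> 0))"

text \<open>The surface measure on the hyperplane \<open>affine hull F\<close>: a set \<open>A\<close> in the hyperplane is given
  the volume of the right prism of height 1 with mid-section \<open>A\<close>.\<close>

definition facet_measure :: "(real^'n) set \<Rightarrow> (real^'n) measure" where
  "facet_measure F =
     distr (restrict_space lborel {y. infdist y (affine hull F) \<le> 1/2}) borel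
       (closest_point (affine hull F))"

definition surface_area :: "(real^'n) set set \<Rightarrow> (real^'n) set \<Rightarrow> ennreal" where
  "surface_area M \<Gamma> = (\<Sum>F\<in>facets M. emeasure (facet_measure F) (F \<inter> \<Gamma>))"


section \<open>Piecewise polynomial functions\<close>

text \<open>A function on a mesh (on a mesh skeleton) that is polynomial on each element (facet), possibly
  with jumps between them, is represented by the family of its restrictions, indexed by the element
  \<open>K\<close> (facet \<open>F\<close>) itself. On an element the restriction is identified with its polynomial extension
  to the whole space (unique, since elements have interior points), so \<open>v K\<close> also gives the trace of
  \<open>v\<close> and of its derivatives on the boundary of \<open>K\<close> from inside \<open>K\<close>. On a facet only the values at
  points of the facet are meaningful. Indices outside the mesh are irrelevant; hence a function on a
  mesh is also a function on each submesh, without explicit restriction.\<close>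

type_synonym ('n, 'b) broken = "(real^'n) set \<Rightarrow> real^'n \<Rightarrow> 'b"

definition Vh :: "nat \<Rightarrow> (real^'n) set set \<Rightarrow> ('n, real^'n) broken set" where
  "Vh k M = {v. \<forall>K\<in>M. v K \<in> vpolys k}"

definition Qh :: "nat \<Rightarrow> (real^'n) set set \<Rightarrow> ('n, real) broken set" where
  "Qh k M = {q. \<forall>K\<in>M. q K \<in> polys (k - 1)}"

definition Vbar :: "nat \<Rightarrow> (real^'n) set set \<Rightarrow> (real^'n) set \<Rightarrow> ('n, real^'n) broken set" where
  "Vbar k M \<Gamma>D = {v. (\<forall>F\<in>facets M. \<exists>p\<in>vpolys k. \<forall>x\<in>F. v F x = p x) \<and>
                     (\<forall>F\<in>facets_on M \<Gamma>D. \<forall>x\<in>F. v F x = 0)}"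

definition Qbar :: "nat \<Rightarrow> (real^'n) set set \<Rightarrow> ('n, real) broken set" where
  "Qbar k M = {q. \<forall>F\<in>facets M. \<exists>p\<in>polys k. \<forall>x\<in>F. q F x = p x}"

definition Qbar0 :: "nat \<Rightarrow> (real^'n) set set \<Rightarrow> (real^'n) set \<Rightarrow> ('n, real) broken set" where
  "Qbar0 k M \<Gamma>P = {q \<in> Qbar k M. \<forall>F\<in>facets_on M \<Gamma>P. \<forall>x\<in>F. q F x = 0}"

definition jump :: "(real^'n) set set \<Rightarrow> ('n, real^'n) broken \<Rightarrow> (real^'n) set \<Rightarrow> real^'n \<Rightarrow> real" where
  "jump M v F x = (\<Sum>K | K \<in> M \<and> F facet_of K. v K x \<bullet> outward_normal K F)"

text \<open>Only for facets on the boundary of the region meshed by \<open>M\<close>: the element next to \<open>F\<close>, the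
  trace on \<open>F\<close> and the outward unit normal of the region on \<open>F\<close>.\<close>

definition bdry_element :: "(real^'n) set set \<Rightarrow> (real^'n) set \<Rightarrow> (real^'n) set" where
  "bdry_element M F = (THE K. K \<in> M \<and> F facet_of K)"

definition bdry_trace :: "(real^'n) set set \<Rightarrow> ('n, 'b) broken \<Rightarrow> ('n, 'b) broken" where
  "bdry_trace M v F = v (bdry_element M F)"

definition bdry_normal :: "(real^'n) set set \<Rightarrow> (real^'n) set \<Rightarrow> real^'n" where
  "bdry_normal M F = outward_normal (bdry_element M F) F"

text \<open>The \<open>L\<^sup>2\<close>-projection onto \<open>Qh k M\<close> is unique on the elements of \<open>M\<close>.\<close>

definition L2_projection ::
    "nat \<Rightarrow> (real^'n) set set \<Rightarrow> (real^'n \<Rightarrow> real) \<Rightarrow> ('n, real) broken" where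
  "L2_projection k M g = (SOME q. q \<in> Qh k M \<and>
     (\<forall>r\<in>Qh k M. (\<Sum>K\<in>M. LINT x:K|lebesgue. q K x * r K x) =
                 (\<Sum>K\<in>M. LINT x:K|lebesgue. g x * r K x)))"

definition time_diff ::
    "real \<Rightarrow> ('n, 'b::real_vector) broken \<Rightarrow> ('n, 'b) broken \<Rightarrow> ('n, 'b) broken" where
  "time_diff \<Delta>t g1 g0 K x = (1 / \<Delta>t) *\<^sub>R (g1 K x - g0 K x)"


section \<open>Forms\<close>

definition elem_integral :: "(real^'n) set set \<Rightarrow> ('n, real) broken \<Rightarrow> real" where
  "elem_integral M \<phi> = (\<Sum>K\<in>M. LINT x:K|lebesgue. \<phi> K x)"

definition facet_integral :: "(real^'n) set set \<Rightarrow> ('n, real) broken \<Rightarrow> real" where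
  "facet_integral \<F> \<phi> = (\<Sum>F\<in>\<F>. LINT x:F|facet_measure F. \<phi> F x)"

definition bdry_integral ::
    "(real^'n) set set \<Rightarrow> ((real^'n) set \<Rightarrow> ('n, real) broken) \<Rightarrow> real" where
  "bdry_integral M \<phi> = (\<Sum>K\<in>M. \<Sum>F | F facet_of K. LINT x:F|facet_measure F. \<phi> K F x)"

definition a_form :: "(real^'n) set set \<Rightarrow> real \<Rightarrow> real \<Rightarrow>
    ('n, real^'n) broken \<times> ('n, real^'n) broken \<Rightarrow>
    ('n, real^'n) broken \<times> ('n, real^'n) broken \<Rightarrow> real" where
  "a_form M \<mu> \<beta> = (\<lambda>(u, ub) (v, vb).
     elem_integral M (\<lambda>K x. (2 * \<mu>) * (sym_grad (u K) x \<bullet> sym_grad (v K) x))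
     + bdry_integral M (\<lambda>K F x. (2 * \<beta> * \<mu> / diameter K) * ((u K x - ub F x) \<bullet> (v K x - vb F x)))
     - bdry_integral M (\<lambda>K F x.
         (2 * \<mu>) * ((sym_grad (u K) x *v outward_normal K F) \<bullet> (v K x - vb F x)))
     - bdry_integral M (\<lambda>K F x.
         (2 * \<mu>) * ((sym_grad (v K) x *v outward_normal K F) \<bullet> (u K x - ub F x))))"

definition b_form :: "(real^'n) set set \<Rightarrow>
    ('n, real) broken \<times> ('n, real) broken \<Rightarrow>
    ('n, real^'n) broken \<times> ('n, real^'n) broken \<Rightarrow> real" where
  "b_form M = (\<lambda>(q, qb) (v, vb).
     - elem_integral M (\<lambda>K x. q K x * divergence (v K) x)
     + bdry_integral M (\<lambda>K F x. qb F x * ((v K x - vb F x) \<bullet> outward_normal K F)))"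

definition c_form :: "(real^'n) set set \<Rightarrow> real \<Rightarrow> real \<Rightarrow>
    ('n, real) broken \<times> ('n, real) broken \<Rightarrow> ('n, real) broken \<Rightarrow> real" where
  "c_form M lam \<alpha> = (\<lambda>(p, r) q.
     elem_integral M (\<lambda>K x. (1 / lam) * (\<alpha> * p K x - r K x) * q K x))"

definition aI_form :: "(real^'n) set set \<Rightarrow> ((real^'n) set \<Rightarrow> real^'n) \<Rightarrow> real \<Rightarrow>
    ('n, real^'n) broken \<times> ('n, real^'n) broken \<Rightarrow>
    ('n, real^'n) broken \<times> ('n, real^'n) broken \<Rightarrow> real" where
  "aI_form \<F>I nrm \<delta> = (\<lambda>(us, ub) (vs, vb).
     facet_integral \<F>I (\<lambda>F x. \<delta> *
       (tangential (nrm F) (us F x - ub F x) \<bullet> tangential (nrm F) (vs F x - vb F x))))"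

definition bI_form :: "(real^'n) set set \<Rightarrow> ((real^'n) set \<Rightarrow> real^'n) \<Rightarrow>
    ('n, real) broken \<Rightarrow> ('n, real^'n) broken \<times> ('n, real^'n) broken \<Rightarrow> real" where
  "bI_form \<F>I nrm q = (\<lambda>(vs, vb). facet_integral \<F>I (\<lambda>F x. q F x * ((vs F x - vb F x) \<bullet> nrm F)))"


section \<open>The Stokes--Biot setting\<close>

datatype side = Stokes | Biot

text \<open>The last two assumptions on the mesh: the two meshes match at the interface, and every facet
  on the outer boundary lies in one part of each boundary partition.\<close>

locale hdg_setting =
  fixes \<Omega> :: "(real^'n) set"
    and sub :: "side \<Rightarrow> (real^'n) set"
    and \<Gamma>D \<Gamma>N :: "side \<Rightarrow> (real^'n) set"
    and \<Gamma>P \<Gamma>F :: "(real^'n) set"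
    and \<T> :: "side \<Rightarrow> (real^'n) set set"
    and \<sigma> :: real
    and k :: nat
    and \<mu> \<beta> :: "side \<Rightarrow> real"
    and lam \<kappa> \<gamma> \<alpha> c\<^sub>0 :: real
    and \<Delta>t T :: real
    and N :: nat
    and f :: "real \<Rightarrow> real^'n \<Rightarrow> real^'n"
    and g :: "real \<Rightarrow> real^'n \<Rightarrow> real"
  assumes dim: "CARD('n) = 2 \<or> CARD('n) = 3"
    and domain: "polyhedral_open \<Omega>" "connected \<Omega>"
    and subdomain: "\<And>j. polyhedral_open (sub j)"
    and decomposition: "sub Stokes \<inter> sub Biot = {}"
      "closure \<Omega> = closure (sub Stokes) \<union> closure (sub Biot)"
    and partition_DN: "\<And>j. \<Gamma>D j \<union> \<Gamma>N j = frontier \<Omega> \<inter> frontier (sub j)" "\<And>j. \<Gamma>D j \<inter> \<Gamma>N j = {}"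
    and partition_PF: "\<Gamma>P \<union> \<Gamma>F = frontier \<Omega> \<inter> frontier (sub Biot)" "\<Gamma>P \<inter> \<Gamma>F = {}"
    and borel_parts: "\<And>j. \<Gamma>D j \<in> sets borel" "\<And>j. \<Gamma>N j \<in> sets borel"
      "\<Gamma>P \<in> sets borel" "\<Gamma>F \<in> sets borel"
    and positive_area: "\<And>j. surface_area (\<T> j) (\<Gamma>D j) > 0" "\<And>j. surface_area (\<T> j) (\<Gamma>N j) > 0"
      "surface_area (\<T> Biot) \<Gamma>P > 0"
    and mesh: "\<And>j. simplicial_mesh (\<T> j) (sub j)"
    and regular: "\<And>j. shape_regular \<sigma> (\<T> j)"
    and matching: "triangulation (\<T> Stokes \<union> \<T> Biot)"
    and aligned: "\<And>j F. F \<in> facets_on (\<T> j) (frontier \<Omega> \<inter> frontier (sub j)) \<Longrightarrow>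
        rel_interior F \<subseteq> \<Gamma>D j \<or> rel_interior F \<subseteq> \<Gamma>N j"
      "\<And>F. F \<in> facets_on (\<T> Biot) (frontier \<Omega> \<inter> frontier (sub Biot)) \<Longrightarrow>
        rel_interior F \<subseteq> \<Gamma>P \<or> rel_interior F \<subseteq> \<Gamma>F"
    and degree: "k \<ge> 1"
    and constants: "\<And>j. \<mu> j > 0" "\<And>j. \<beta> j > 0" "lam > 0" "\<kappa> > 0" "\<gamma> > 0" "0 < \<alpha>" "\<alpha> < 1" "c\<^sub>0 \<ge> 0"
    and time: "\<Delta>t > 0" "real N * \<Delta>t = T"
    and data: "\<And>j t. t \<in> {0..T} \<Longrightarrow> f t square_integrable_on sub j"
      "\<And>t. t \<in> {0..T} \<Longrightarrow> g t square_integrable_on sub Biot"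

definition interface :: "(side \<Rightarrow> (real^'n) set) \<Rightarrow> (real^'n) set" where
  "interface sub = frontier (sub Stokes) \<inter> frontier (sub Biot)"

definition interface_facets ::
    "(side \<Rightarrow> (real^'n) set) \<Rightarrow> (side \<Rightarrow> (real^'n) set set) \<Rightarrow> (real^'n) set set" where
  "interface_facets sub \<T> = facets_on (\<T> Stokes \<union> \<T> Biot) (interface sub)"

text \<open>The normal on the interface points from the Stokes to the Biot region.\<close>

definition interface_normal :: "(side \<Rightarrow> (real^'n) set set) \<Rightarrow> (real^'n) set \<Rightarrow> real^'n" where
  "interface_normal \<T> = bdry_normal (\<T> Stokes)"

record ('n::finite) hdg_fields =
  vel :: "('n, real^'n) broken"
  vel_bar :: "side \<Rightarrow> ('n, real^'n) broken"
  pres :: "('n, real) broken"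
  pres_bar :: "side \<Rightarrow> ('n, real) broken"
  darcy :: "('n, real^'n) broken"
  pore :: "('n, real) broken"
  pore_bar :: "('n, real) broken"

definition Xh :: "nat \<Rightarrow> (side \<Rightarrow> (real^'n) set set) \<Rightarrow> (side \<Rightarrow> (real^'n) set) \<Rightarrow> (real^'n) set \<Rightarrow>
    'n hdg_fields set" where
  "Xh k \<T> \<Gamma>D \<Gamma>P = {X.
     vel X \<in> Vh k (\<T> Stokes \<union> \<T> Biot) \<and> (\<forall>j. vel_bar X j \<in> Vbar k (\<T> j) (\<Gamma>D j)) \<and>
     pres X \<in> Qh k (\<T> Stokes \<union> \<T> Biot) \<and> (\<forall>j. pres_bar X j \<in> Qbar k (\<T> j)) \<and>
     darcy X \<in> Vh k (\<T> Biot) \<and>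
     pore X \<in> Qh k (\<T> Biot) \<and> pore_bar X \<in> Qbar0 k (\<T> Biot) \<Gamma>P}"

text \<open>\<open>X\<close> solves one time step of the method, given the fields \<open>X0\<close> at the previous time level and
  the data \<open>f\<close>, \<open>g\<close> at the new time level.\<close>

definition hdg_step ::
    "(side \<Rightarrow> (real^'n) set) \<Rightarrow> (side \<Rightarrow> (real^'n) set) \<Rightarrow> (real^'n) set \<Rightarrow>
     (side \<Rightarrow> (real^'n) set set) \<Rightarrow> nat \<Rightarrow> (side \<Rightarrow> real) \<Rightarrow> (side \<Rightarrow> real) \<Rightarrow>
     real \<Rightarrow> real \<Rightarrow> real \<Rightarrow> real \<Rightarrow> real \<Rightarrow> real \<Rightarrow>
     (real^'n \<Rightarrow> real^'n) \<Rightarrow> (real^'n \<Rightarrow> real) \<Rightarrow> 'n hdg_fields \<Rightarrow> 'n hdg_fields \<Rightarrow> bool" where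
  "hdg_step sub \<Gamma>D \<Gamma>P \<T> k \<mu> \<beta> lam \<kappa> \<gamma> \<alpha> c\<^sub>0 \<Delta>t f g X0 X \<longleftrightarrow>
    (let a = (\<lambda>j. a_form (\<T> j) (\<mu> j) (\<beta> j));
         b = (\<lambda>j. b_form (\<T> j));
         c = c_form (\<T> Biot) lam \<alpha>;
         aI = aI_form (interface_facets sub \<T>) (interface_normal \<T>) (\<gamma> * sqrt (\<mu> Stokes / \<kappa>));
         bI = bI_form (interface_facets sub \<T>) (interface_normal \<T>);
         dt_vel_bar = time_diff \<Delta>t (vel_bar X Biot) (vel_bar X0 Biot);
         dt_pres = time_diff \<Delta>t (pres X) (pres X0);
         dt_pore = time_diff \<Delta>t (pore X) (pore X0)
     in
      X \<in> Xh k \<T> \<Gamma>D \<Gamma>P \<and>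
      (\<forall>Y \<in> Xh k \<T> \<Gamma>D \<Gamma>P.
        a Stokes (vel X, vel_bar X Stokes) (vel Y, vel_bar Y Stokes)
        + a Biot (vel X, vel_bar X Biot) (vel Y, vel_bar Y Biot)
        + aI (vel_bar X Stokes, dt_vel_bar) (vel_bar Y Stokes, vel_bar Y Biot)
        + b Stokes (pres X, pres_bar X Stokes) (vel Y, vel_bar Y Stokes)
        + b Biot (pres X, pres_bar X Biot) (vel Y, vel_bar Y Biot)
        + bI (pore_bar X) (vel_bar Y Stokes, vel_bar Y Biot)
        = elem_integral (\<T> Stokes \<union> \<T> Biot) (\<lambda>K x. f x \<bullet> vel Y K x)
      \<and>
        b Stokes (pres Y, pres_bar Y Stokes) (vel X, vel_bar X Stokes)
        + b Biot (pres Y, pres_bar Y Biot) (vel X, vel_bar X Biot)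
        + c (pore X, pres X) (pres Y)
        = 0
      \<and>
        elem_integral (\<T> Biot) (\<lambda>K x. c\<^sub>0 * dt_pore K x * pore Y K x)
        + c (dt_pore, dt_pres) (\<lambda>K x. \<alpha> * pore Y K x)
        - b Biot (pore Y, pore_bar Y) (darcy X, (\<lambda>F x. 0))
        - bI (pore_bar Y) (vel_bar X Stokes, dt_vel_bar)
        = elem_integral (\<T> Biot) (\<lambda>K x. g x * pore Y K x)
      \<and>
        elem_integral (\<T> Biot) (\<lambda>K x. (1 / \<kappa>) * (darcy X K x \<bullet> darcy Y K x))
        + b Biot (pore X, pore_bar X) (darcy Y, (\<lambda>F x. 0))
        = 0))"

end

theory Submission
  imports Defs
begin

text \<open>Every conclusion says that a piecewise polynomial residual vanishes, and in each case the scheme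
  says that this residual is orthogonal to a polynomial space to which it belongs. Testing with the
  residual itself then makes its \<open>L\<^sup>2\<close>-norm zero. The orthogonality comes from the two equations
  with scalar test functions, the mass equation and the pore pressure equation.

  On the elements this works because the divergence lowers the polynomial degree by one
  (\<open>divergence_polys\<close>), which brings the residuals into \<open>Qh\<close>. This gives \<open>velocity_divergence\<close> and
  \<open>darcy_divergence\<close>. On the skeleton, the sums over element boundaries are reordered into a
  sum over facets (\<open>bdry_integral_by_facets\<close>); the residual at a facet is then a sum over the elements
  that meet there, and it vanishes by \<open>velocity_facet_balance\<close> and \<open>darcy_facet_balance\<close>. Testing with
  the residual is conclusive because the surface measure of a facet charges each of its relatively
  open pieces (\<open>facet_measure_pos\<close>).

  It remains to interpret these sums, which is convex geometry. Two elements of a triangulation with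
  a common facet lie on opposite sides of it, have opposite outward normals there, and together cover a
  neighbourhood of its relative interior (\<open>two_elements_at_facet\<close>). Hence a facet inside a domain has
  exactly two elements (\<open>interior_facet_elements\<close>), the sum is a jump, and the facet unknown cancels. A
  facet on the boundary has just one (\<open>boundary_facet_element\<close>), and the sum compares the trace with
  the facet unknown. A facet on the interface has one element on each side
  (\<open>interface_facet_sides\<close>), and its Darcy balance couples the two velocities.\<close>

section \<open>Polynomials and their derivatives\<close>

lemma finite_multi_indices: "finite {a :: 'n::finite \<Rightarrow> nat. (\<Sum>i\<in>UNIV. a i) \<le> k}"
proof (rule finite_subset)
  show "{a :: 'n \<Rightarrow> nat. (\<Sum>i\<in>UNIV. a i) \<le> k} \<subseteq> PiE UNIV (\<lambda>_. {..k})"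
  proof (clarsimp simp: PiE_def)
    fix a :: "'n \<Rightarrow> nat" and i assume "(\<Sum>i\<in>UNIV. a i) \<le> k"
    moreover have "a i \<le> (\<Sum>i\<in>UNIV. a i)" by (rule member_le_sum) auto
    ultimately show "a i \<le> k" by simp
  qed
  show "finite (PiE (UNIV :: 'n set) (\<lambda>_. {..k}))" by (intro finite_PiE) auto
qed

lemma polys_lincomb:
  assumes "p \<in> polys k" "q \<in> polys k"
  shows "(\<lambda>x. s * p x + t * q x) \<in> polys k"
proof -
  obtain c d where
    c: "\<And>x. p x = (\<Sum>a | (\<Sum>i\<in>UNIV. a i) \<le> k. c a * (\<Prod>i\<in>UNIV. (x $ i) ^ a i))" and
    d: "\<And>x. q x = (\<Sum>a | (\<Sum>i\<in>UNIV. a i) \<le> k. d a * (\<Prod>i\<in>UNIV. (x $ i) ^ a i))"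
    using assms unfolding polys_def by auto
  show ?thesis unfolding polys_def
    by (intro CollectI exI[of _ "\<lambda>a. s * c a + t * d a"] allI)
      (simp add: c d sum_distrib_left sum.distrib algebra_simps)
qed

lemma polys_zero: "(\<lambda>x. 0) \<in> polys k"
  unfolding polys_def by (intro CollectI exI[of _ "\<lambda>a. 0"]) simp

lemma polys_add: "p \<in> polys k \<Longrightarrow> q \<in> polys k \<Longrightarrow> (\<lambda>x. p x + q x) \<in> polys k"
  using polys_lincomb[of p k q 1 1] by simp

lemma polys_diff: "p \<in> polys k \<Longrightarrow> q \<in> polys k \<Longrightarrow> (\<lambda>x. p x - q x) \<in> polys k"
  using polys_lincomb[of p k q 1 "-1"] by simp

lemma polys_cmult: "p \<in> polys k \<Longrightarrow> (\<lambda>x. s * p x) \<in> polys k"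
  using polys_lincomb[of p k p s 0] by simp

lemma polys_sum:
  "(\<And>i. i \<in> I \<Longrightarrow> p i \<in> polys k) \<Longrightarrow> (\<lambda>x. \<Sum>i\<in>I. p i x) \<in> polys k"
  by (induction I rule: infinite_finite_induct) (auto intro: polys_zero polys_add)

lemma polys_monomial:
  assumes "(\<Sum>i\<in>UNIV. a i) \<le> k"
  shows "(\<lambda>x. \<Prod>i\<in>UNIV. (x $ i) ^ a i) \<in> polys k"
  unfolding polys_def
proof (intro CollectI exI[of _ "\<lambda>b. if b = a then 1 else 0"] allI)
  fix x :: "real^'a"
  have "(\<Sum>b | (\<Sum>i\<in>UNIV. b i) \<le> k. (if b = a then 1 else 0) * (\<Prod>i\<in>UNIV. (x $ i) ^ b i))
      = (\<Sum>b | (\<Sum>i\<in>UNIV. b i) \<le> k. if b = a then (\<Prod>i\<in>UNIV. (x $ i) ^ a i) else 0)"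
    by (rule sum.cong) auto
  also have "\<dots> = (\<Prod>i\<in>UNIV. (x $ i) ^ a i)"
    using assms by (simp add: sum.delta finite_multi_indices)
  finally show "(\<Prod>i\<in>UNIV. (x $ i) ^ a i) = (\<Sum>b | (\<Sum>i\<in>UNIV. b i) \<le> k.
      (if b = a then 1 else 0) * (\<Prod>i\<in>UNIV. (x $ i) ^ b i))" ..
qed

lemma polys_continuous: "p \<in> polys k \<Longrightarrow> continuous_on S p"
  unfolding polys_def by (auto simp: fun_eq_iff[symmetric] intro!: continuous_intros)

lemma monomial_partial_derivative:
  fixes a :: "'n::finite \<Rightarrow> nat"
  assumes "(\<Sum>i\<in>UNIV. a i) \<le> k"
  shows "\<exists>D. (\<forall>x. ((\<lambda>x. \<Prod>i\<in>UNIV. (x $ i) ^ a i) has_derivative D x) (at x)) \<and>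
             (\<forall>j. (\<lambda>x. D x (axis j 1)) \<in> polys (k - 1))"
proof -
  define D where "D x h =
    (\<Sum>i\<in>UNIV. real (a i) * h $ i * x $ i ^ (a i - 1) * (\<Prod>l\<in>UNIV - {i}. (x $ l) ^ a l))"
    for x h :: "real^'n"
  have "((\<lambda>x. \<Prod>i\<in>UNIV. (x $ i) ^ a i) has_derivative D x) (at x)" for x :: "real^'n"
    unfolding D_def
    by (rule has_derivative_prod has_derivative_power bounded_linear_imp_has_derivative
          bounded_linear_vec_nth refl)+
  moreover have "(\<lambda>x. D x (axis j 1)) \<in> polys (k - 1)" for j
  proof (cases "a j = 0")
    case True
    have "D x (axis j 1) = 0" for x :: "real^'n"
      unfolding D_def by (rule sum.neutral) (use True in \<open>auto simp: axis_def\<close>)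
    then show ?thesis by (simp add: polys_zero)
  next
    case False
    define b where "b = a(j := a j - 1)"
    have "(\<Sum>i\<in>UNIV. b i) = a j - 1 + (\<Sum>i\<in>UNIV-{j}. a i)"
      unfolding b_def by (subst sum.remove[of _ j]) auto
    moreover have "(\<Sum>i\<in>UNIV. a i) = a j + (\<Sum>i\<in>UNIV-{j}. a i)"
      by (subst sum.remove[of _ j]) auto
    ultimately have deg: "(\<Sum>i\<in>UNIV. b i) \<le> k - 1" using False assms by simp
    have "D x (axis j 1) = real (a j) * (\<Prod>i\<in>UNIV. (x $ i) ^ b i)" for x :: "real^'n"
    proof -
      have "D x (axis j 1) = (\<Sum>i\<in>UNIV. if i = j then
          real (a j) * (x $ j ^ (a j - 1)) * (\<Prod>l\<in>UNIV - {j}. (x $ l) ^ a l) else 0)"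
        unfolding D_def by (rule sum.cong) (auto simp: axis_def)
      also have "\<dots> = real (a j) * ((x $ j ^ b j) * (\<Prod>l\<in>UNIV - {j}. (x $ l) ^ b l))"
        by (simp add: sum.delta b_def)
      finally show ?thesis by (subst prod.remove[of _ j]) auto
    qed
    then show ?thesis using polys_cmult[OF polys_monomial[OF deg]] by presburger
  qed
  ultimately show ?thesis by blast
qed

lemma polys_partial_derivative:
  assumes "p \<in> polys k"
  shows "\<exists>D. (\<forall>x. (p has_derivative D x) (at x)) \<and> (\<forall>j. (\<lambda>x. D x (axis j 1)) \<in> polys (k - 1))"
proof -
  obtain c where c: "p = (\<lambda>x. \<Sum>a | (\<Sum>i\<in>UNIV. a i) \<le> k. c a * (\<Prod>i\<in>UNIV. (x $ i) ^ a i))"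
    using assms unfolding polys_def by (auto simp: fun_eq_iff)
  have "\<forall>a\<in>{a. (\<Sum>i\<in>UNIV. a i) \<le> k}. \<exists>D.
      (\<forall>x. ((\<lambda>x::real^'a. \<Prod>i\<in>UNIV. (x $ i) ^ a i) has_derivative D x) (at x)) \<and>
      (\<forall>j. (\<lambda>x. D x (axis j 1)) \<in> polys (k - 1))"
    using monomial_partial_derivative by blast
  from bchoice[OF this] obtain D where
    D: "\<And>a x. (\<Sum>i\<in>UNIV. a i) \<le> k \<Longrightarrow>
          ((\<lambda>x::real^'a. \<Prod>i\<in>UNIV. (x $ i) ^ a i) has_derivative D a x) (at x)"
    and DP: "\<And>a j. (\<Sum>i\<in>UNIV. a i) \<le> k \<Longrightarrow> (\<lambda>x. D a x (axis j 1)) \<in> polys (k - 1)"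
    by blast
  show ?thesis
  proof (intro exI[of _ "\<lambda>x h. \<Sum>a | (\<Sum>i\<in>UNIV. a i) \<le> k. c a * D a x h"] conjI allI)
    show "(p has_derivative (\<lambda>h. \<Sum>a | (\<Sum>i\<in>UNIV. a i) \<le> k. c a * D a x h)) (at x)" for x
      unfolding c by (intro has_derivative_sum has_derivative_mult_right) (auto intro: D)
    show "(\<lambda>x. \<Sum>a | (\<Sum>i\<in>UNIV. a i) \<le> k. c a * D a x (axis j 1)) \<in> polys (k - 1)" for j
      by (intro polys_sum polys_cmult DP) auto
  qed
qed

text \<open>This is why the divergence of a velocity in \<open>Vh k M\<close> is itself an admissible scalar test function.\<close>

lemma divergence_polys:
  assumes "v \<in> vpolys k"
  shows "divergence v \<in> polys (k - 1)"
proof -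
  have "\<forall>i. \<exists>D. (\<forall>x. ((\<lambda>x. v x $ i) has_derivative D x) (at x)) \<and>
      (\<forall>j. (\<lambda>x. D x (axis j 1)) \<in> polys (k - 1))"
    using assms polys_partial_derivative unfolding vpolys_def by blast
  from choice[OF this] obtain D where
    D: "\<And>i x. ((\<lambda>x. v x $ i) has_derivative D i x) (at x)"
    and DP: "\<And>i j. (\<lambda>x. D i x (axis j 1)) \<in> polys (k - 1)" by blast
  have "divergence v x = (\<Sum>i\<in>UNIV. D i x (axis i 1))" for x
  proof -
    have "(v has_derivative (\<lambda>h. \<chi> i. D i x h)) (at x)"
    proof (subst has_derivative_componentwise_within, intro ballI)
      fix b :: "real^'a" assume "b \<in> Basis"
      then obtain i where "b = axis i 1" by (auto simp: Basis_vec_def)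
      then show "((\<lambda>x. v x \<bullet> b) has_derivative (\<lambda>h. (\<chi> i. D i x h) \<bullet> b)) (at x)"
        using D[of i x] by (simp add: inner_axis)
    qed
    then have "frechet_derivative v (at x) = (\<lambda>h. \<chi> i. D i x h)"
      using frechet_derivative_at by metis
    then show ?thesis by (simp add: divergence_def grad_def jacobian_def trace_def matrix_def)
  qed
  then have "divergence v = (\<lambda>x. \<Sum>i\<in>UNIV. D i x (axis i 1))" by auto
  then show ?thesis using DP by (auto intro: polys_sum)
qed

lemma vpolys_inner: "v \<in> vpolys k \<Longrightarrow> (\<lambda>x. v x \<bullet> m) \<in> polys k"
  unfolding inner_vec_def vpolys_def inner_real_def
  by (subst mult.commute) (auto intro!: polys_sum polys_cmult)

section \<open>Outward normals and the elements that meet at a facet\<close>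

lemma facet_supporting_hyperplane:
  fixes K :: "(real^'n) set"
  assumes "polytope K" "interior K \<noteq> {}" "F facet_of K"
  obtains a b where "norm a = 1" "\<And>x. x \<in> K \<Longrightarrow> a \<bullet> x \<le> b" "affine hull F = {x. a \<bullet> x = b}"
proof -
  have F: "F face_of K" "F \<noteq> {}" "aff_dim F = aff_dim K - 1"
    using assms(3) by (auto simp: facet_of_def)
  have dimK: "aff_dim K = int CARD('n)" using assms(2) by (simp add: aff_dim_nonempty_interior)
  have "F exposed_face_of K"
    using F(1) assms(1) exposed_face_of_polyhedron polytope_imp_polyhedron by blast
  then obtain a b where ab: "K \<subseteq> {x. a \<bullet> x \<le> b}" "F = K \<inter> {x. a \<bullet> x = b}"
    unfolding exposed_face_of_def by blast
  have "a \<noteq> 0"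
  proof
    assume "a = 0"
    then have "F = K \<or> F = {}" using ab by auto
    then show False using F by auto
  qed
  have "affine hull F = {x. a \<bullet> x = b}"
  proof (rule affine_dim_equal)
    show "affine hull F \<subseteq> {x. a \<bullet> x = b}"
      using ab(2) by (intro hull_minimal) (auto simp: affine_hyperplane)
    show "aff_dim (affine hull F) = aff_dim {x. a \<bullet> x = b}"
      using \<open>a \<noteq> 0\<close> F(3) dimK by (simp add: aff_dim_affine_hull)
  qed (use F(2) in \<open>auto simp: affine_hyperplane\<close>)
  moreover have "{x. a \<bullet> x = b} = {x. (a /\<^sub>R norm a) \<bullet> x = b / norm a}"
    using \<open>a \<noteq> 0\<close> by (auto simp: field_simps)
  moreover have "(a /\<^sub>R norm a) \<bullet> x \<le> b / norm a" if "x \<in> K" for x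
    using ab(1) that \<open>a \<noteq> 0\<close> by (auto simp: field_simps)
  moreover have "norm (a /\<^sub>R norm a) = 1" using \<open>a \<noteq> 0\<close> by simp
  ultimately show ?thesis using that by metis
qed

lemma inner_constant_on_affine_hull:
  fixes m :: "'a::euclidean_space"
  assumes "\<And>y. y \<in> F \<Longrightarrow> m \<bullet> y = c" "z \<in> affine hull F"
  shows "m \<bullet> z = c"
proof -
  have "affine hull F \<subseteq> {x. m \<bullet> x = c}"
    by (rule hull_minimal) (use assms(1) in \<open>auto simp: affine_hyperplane\<close>)
  then show ?thesis using assms(2) by auto
qed

text \<open>The description by \<open>THE\<close> is met by the unit normal of a supporting hyperplane through the facet,
  and by nothing else: any such vector is constant on the facet, hence orthogonal to the
  hyperplane, and the interior points of the element decide its sign.\<close>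

lemma outward_normal_eq:
  fixes K :: "(real^'n) set"
  assumes int: "interior K \<noteq> {}" and F: "F facet_of K"
    and a: "norm a = 1" "\<And>x. x \<in> K \<Longrightarrow> a \<bullet> x \<le> b" "affine hull F = {x. a \<bullet> x = b}"
  shows "outward_normal K F = a"
  unfolding outward_normal_def
proof (rule the_equality)
  have FK: "F \<subseteq> K" "F \<noteq> {}" using F by (auto simp: facet_of_def face_of_def)
  have Fb: "a \<bullet> y = b" if "y \<in> F" for y using hull_inc[of y F affine] that a(3) by blast
  show "norm a = 1 \<and> (\<forall>x\<in>K. \<forall>y\<in>F. a \<bullet> (x - y) \<le> 0)"
    using a(1,2) Fb by (auto simp: inner_diff_right)
  fix m :: "real^'n" assume m: "norm m = 1 \<and> (\<forall>x\<in>K. \<forall>y\<in>F. m \<bullet> (x - y) \<le> 0)"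
  obtain y0 where y0: "y0 \<in> F" using FK by blast
  have "m \<bullet> y = m \<bullet> y0" if "y \<in> F" for y
  proof (rule antisym)
    show "m \<bullet> y \<le> m \<bullet> y0" using m that y0 FK by (force simp: inner_diff_right)
    show "m \<bullet> y0 \<le> m \<bullet> y" using m that y0 FK by (force simp: inner_diff_right)
  qed
  then have mconst: "m \<bullet> z = m \<bullet> y0" if "a \<bullet> z = b" for z
    using inner_constant_on_affine_hull[of F m "m \<bullet> y0" z] that a(3) by auto
  \<comment> \<open>The part \<open>w\<close> of \<open>m\<close> orthogonal to \<open>a\<close> is a direction of the hyperplane, where \<open>m\<close> is constant.\<close>
  define w where "w = m - (a \<bullet> m) *\<^sub>R a"
  have aw: "a \<bullet> w = 0" using a(1) by (simp add: w_def inner_diff_right dot_square_norm)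
  have "m \<bullet> (y0 + w) = m \<bullet> y0" by (rule mconst) (simp add: inner_add_right aw Fb[OF y0])
  then have "m \<bullet> w = 0" by (simp add: inner_add_right)
  then have "w \<bullet> w = 0" using aw by (simp add: w_def inner_diff_left)
  then have ma: "m = (a \<bullet> m) *\<^sub>R a" by (simp add: w_def)
  have "\<bar>a \<bullet> m\<bar> = 1" using arg_cong[OF ma, of norm] m a(1) by simp
  moreover have "a \<bullet> m \<noteq> -1"
  proof
    assume "a \<bullet> m = -1"
    then have "m = - a" by (subst ma) simp
    then have "a \<bullet> x = b" if "x \<in> K" for x
      using m that y0 a(2)[OF that] Fb[OF y0] by (force simp: inner_diff_right)
    then have "K \<subseteq> {x. a \<bullet> x = b}" by auto
    moreover have "interior {x. a \<bullet> x = b} = {}" using a(1) by (intro interior_hyperplane) auto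
    ultimately show False using int interior_mono by blast
  qed
  ultimately have "a \<bullet> m = 1" by linarith
  then show "m = a" by (subst ma) simp
qed

lemma outward_normal_supports:
  fixes K :: "(real^'n) set"
  assumes "polytope K" "interior K \<noteq> {}" "F facet_of K"
  obtains b where "norm (outward_normal K F) = 1" "\<And>x. x \<in> K \<Longrightarrow> outward_normal K F \<bullet> x \<le> b"
    "affine hull F = {x. outward_normal K F \<bullet> x = b}"
  using facet_supporting_hyperplane[OF assms] outward_normal_eq[OF assms(2,3)] by metis

text \<open>Near a relative interior point of a facet, the element fills its side of the hyperplane: a
  nearby point of that side lies on a segment from a fixed interior point of the element to a point
  of the hyperplane which is again close to the given point of the facet.\<close>

lemma half_ball_at_facet:
  fixes K :: "(real^'n) set"
  assumes K: "convex K" "interior K \<noteq> {}" "F \<subseteq> K"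
    and a: "a \<noteq> 0" "\<And>x. x \<in> K \<Longrightarrow> a \<bullet> x \<le> b" "affine hull F = {x. a \<bullet> x = b}"
    and y0: "y0 \<in> rel_interior F"
  obtains e where "e > 0" "\<And>x. x \<in> ball y0 e \<Longrightarrow> a \<bullet> x \<le> b \<Longrightarrow> x \<in> K"
proof -
  obtain p where p: "p \<in> K" "a \<bullet> p < b"
  proof -
    have "interior {x. a \<bullet> x = b} = {}" using a(1) by (intro interior_hyperplane) auto
    then have "\<not> K \<subseteq> {x. a \<bullet> x = b}" using K(2) interior_mono by blast
    then obtain p where "p \<in> K" "a \<bullet> p \<noteq> b" by blast
    then show ?thesis using a(2)[of p] that by force
  qed
  obtain d where d: "d > 0" "ball y0 d \<inter> affine hull F \<subseteq> F" and y0F: "y0 \<in> F"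
    using y0 by (auto simp: mem_rel_interior_ball)
  have ay0: "a \<bullet> y0 = b" using hull_inc[OF y0F, of affine] a(3) by blast
  \<comment> \<open>\<open>y x\<close> is the point where the line from \<open>p\<close> through \<open>x\<close> meets the hyperplane.\<close>
  define t where "t x = (b - a \<bullet> x) / (b - a \<bullet> p)" for x
  define y where "y x = (x - t x *\<^sub>R p) /\<^sub>R (1 - t x)" for x
  have t0: "t y0 = 0" by (simp add: t_def ay0)
  have ct: "isCont t y0" unfolding t_def by (intro continuous_intros) (use p in auto)
  have cy: "isCont y y0" unfolding y_def by (intro continuous_intros ct) (use t0 in auto)
  have "y y0 = y0" by (simp add: y_def t0)
  then obtain e1 where e1: "e1 > 0" "\<And>x. dist x y0 < e1 \<Longrightarrow> dist (y x) y0 < d"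
    using cy d(1) unfolding continuous_at by (metis LIM_def dist_self)
  obtain e2 where e2: "e2 > 0" "\<And>x. dist x y0 < e2 \<Longrightarrow> \<bar>t x\<bar> < 1"
    using ct t0 unfolding continuous_at LIM_def
    by (metis dist_real_def diff_zero dist_self zero_less_one)
  have "x \<in> K" if x: "x \<in> ball y0 (min e1 e2)" "a \<bullet> x \<le> b" for x
  proof -
    have tx: "0 \<le> t x" "t x < 1"
      using x e2(2)[of x] p by (auto simp: t_def dist_commute)
    have tp: "t x * (b - a \<bullet> p) = b - a \<bullet> x" using p by (simp add: t_def)
    have "a \<bullet> x - t x * (a \<bullet> p) = (1 - t x) * b" using tp by (simp add: algebra_simps)
    moreover have "a \<bullet> y x = (a \<bullet> x - t x * (a \<bullet> p)) / (1 - t x)"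
      by (simp add: y_def inner_diff_right divide_inverse mult.commute)
    ultimately have "a \<bullet> y x = b" using tx by simp
    moreover have "y x \<in> ball y0 d" using e1(2)[of x] x by (auto simp: dist_commute)
    ultimately have "y x \<in> K" using d(2) a(3) K(3) by blast
    moreover have "x = (1 - t x) *\<^sub>R y x + t x *\<^sub>R p" using tx by (simp add: y_def)
    ultimately show ?thesis
      using convexD[OF K(1) \<open>y x \<in> K\<close> p(1), of "1 - t x" "t x"] tx by simp
  qed
  then show ?thesis using that[of "min e1 e2"] e1(1) e2(1) by auto
qed

text \<open>A proper face has smaller dimension, so it has no interior points.\<close>

lemma face_with_interior_eq:
  fixes K :: "'a::euclidean_space set"
  assumes "convex K" "T face_of K" "interior T \<noteq> {}"
  shows "T = K"
proof (rule ccontr)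
  assume "T \<noteq> K"
  then have "aff_dim T < aff_dim K" using face_of_aff_dim_lt assms by blast
  moreover have "aff_dim T = int DIM('a)" using assms(3) by (rule aff_dim_nonempty_interior)
  ultimately show False using aff_dim_le_DIM[of K] by simp
qed

text \<open>Two elements with a common facet have the same hyperplane through it. On the same side of it
  their interiors would meet near the facet, which a triangulation excludes; hence they lie on
  opposite sides, and together they fill a neighbourhood of the facet's relative interior.\<close>

lemma two_elements_at_facet:
  fixes K1 K2 :: "(real^'n) set"
  assumes M: "triangulation M" "K1 \<in> M" "K2 \<in> M" "K1 \<noteq> K2"
    and int: "interior K1 \<noteq> {}" "interior K2 \<noteq> {}"
    and F: "F facet_of K1" "F facet_of K2"
  shows "outward_normal K2 F = - outward_normal K1 F"
    and "rel_interior F \<subseteq> interior (K1 \<union> K2)"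
proof -
  have pol: "polytope K1" "polytope K2"
    using M simplex_imp_polytope unfolding triangulation_def by blast+
  then have conv: "convex K1" "convex K2" by (auto simp: polytope_imp_convex)
  have sub: "F \<subseteq> K1" "F \<subseteq> K2" using F by (auto simp: facet_of_imp_subset)
  obtain b1 where n1: "norm (outward_normal K1 F) = 1"
      "\<And>x. x \<in> K1 \<Longrightarrow> outward_normal K1 F \<bullet> x \<le> b1"
      "affine hull F = {x. outward_normal K1 F \<bullet> x = b1}"
    using outward_normal_supports[OF pol(1) int(1) F(1)] by metis
  obtain b2 where n2: "norm (outward_normal K2 F) = 1"
      "\<And>x. x \<in> K2 \<Longrightarrow> outward_normal K2 F \<bullet> x \<le> b2"
      "affine hull F = {x. outward_normal K2 F \<bullet> x = b2}"
    using outward_normal_supports[OF pol(2) int(2) F(2)] by metis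
  define a where "a = outward_normal K1 F"
  define m where "m = outward_normal K2 F"
  have F0: "F \<noteq> {}" "convex F" using F(1) by (auto simp: facet_of_def face_of_def)
  have nz: "a \<noteq> 0" "m \<noteq> 0" using n1(1) n2(1) by (auto simp: a_def m_def)
  have same: "m \<bullet> x = b2" if "a \<bullet> x = b1" for x
  proof -
    have "x \<in> affine hull F" using that unfolding n1(3) a_def by simp
    then show ?thesis unfolding n2(3) m_def by simp
  qed
  obtain y0 where y0: "y0 \<in> rel_interior F" using F0 rel_interior_eq_empty by blast
  then have y0F: "y0 \<in> affine hull F" by (metis hull_inc rel_interior_subset subsetD)
  have "a \<bullet> y0 = b1" using y0F unfolding n1(3) a_def by simp
  moreover have "m \<bullet> y0 = b2" using y0F unfolding n2(3) m_def by simp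
  ultimately have ab: "a \<bullet> y0 = b1" "m \<bullet> y0 = b2" .
  have ma: "m = (a \<bullet> m) *\<^sub>R a"
  proof -
    define w where "w = m - (a \<bullet> m) *\<^sub>R a"
    have aw: "a \<bullet> w = 0" using n1(1) by (simp add: w_def a_def inner_diff_right dot_square_norm)
    have "m \<bullet> (y0 + w) = b2" by (rule same) (simp add: inner_add_right aw ab)
    then have "m \<bullet> w = 0" using ab by (simp add: inner_add_right)
    then have "w \<bullet> w = 0" using aw by (simp add: w_def inner_diff_left)
    then show ?thesis by (simp add: w_def)
  qed
  have "\<bar>a \<bullet> m\<bar> = 1"
    using arg_cong[OF ma, of norm] n1(1) n2(1) by (simp add: a_def m_def)
  moreover have "a \<bullet> m \<noteq> 1"
  proof
    assume "a \<bullet> m = 1"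
    then have "m = a" by (subst ma) simp
    then have "b1 = b2" using ab by simp
    obtain e1 where e1: "e1 > 0" "\<And>x. x \<in> ball y0 e1 \<Longrightarrow> a \<bullet> x \<le> b1 \<Longrightarrow> x \<in> K1"
      using half_ball_at_facet[OF conv(1) int(1) sub(1) _ n1(2,3) y0] nz unfolding a_def by metis
    obtain e2 where e2: "e2 > 0" "\<And>x. x \<in> ball y0 e2 \<Longrightarrow> m \<bullet> x \<le> b2 \<Longrightarrow> x \<in> K2"
      using half_ball_at_facet[OF conv(2) int(2) sub(2) _ n2(2,3) y0] nz unfolding m_def by metis
    let ?U = "ball y0 (min e1 e2) \<inter> {x. a \<bullet> x < b1}"
    have "?U \<subseteq> K1 \<inter> K2" using e1 e2 \<open>m = a\<close> \<open>b1 = b2\<close> by auto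
    moreover have "open ?U" by (intro open_Int open_ball open_halfspace_lt)
    moreover have "?U \<noteq> {}"
    proof -
      define s where "s = min e1 e2 / 2"
      have s: "s > 0" "s < min e1 e2" using e1(1) e2(1) by (auto simp: s_def)
      have "dist y0 (y0 - s *\<^sub>R a) = s" using s n1(1) by (simp add: dist_norm a_def)
      moreover have "a \<bullet> (y0 - s *\<^sub>R a) < b1"
        using ab s n1(1) by (simp add: inner_diff_right a_def dot_square_norm)
      ultimately have "y0 - s *\<^sub>R a \<in> ?U" using s by auto
      then show ?thesis by blast
    qed
    ultimately have "interior (K1 \<inter> K2) \<noteq> {}" using interior_maximal by blast
    moreover have "(K1 \<inter> K2) face_of K1" "(K2 \<inter> K1) face_of K2"
      using M unfolding triangulation_def by auto
    ultimately have "K1 \<inter> K2 = K1" "K1 \<inter> K2 = K2"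
      using face_with_interior_eq conv by (metis inf_commute)+
    then show False using M(4) by simp
  qed
  ultimately have "a \<bullet> m = -1" by linarith
  then have "m = - a" by (subst ma) simp
  then show "outward_normal K2 F = - outward_normal K1 F" by (simp add: a_def m_def)
  have b2: "b2 = - b1" using ab \<open>m = - a\<close> by simp
  show "rel_interior F \<subseteq> interior (K1 \<union> K2)"
  proof
    fix z assume z: "z \<in> rel_interior F"
    obtain e1 where e1: "e1 > 0" "\<And>x. x \<in> ball z e1 \<Longrightarrow> a \<bullet> x \<le> b1 \<Longrightarrow> x \<in> K1"
      using half_ball_at_facet[OF conv(1) int(1) sub(1) _ n1(2,3) z] nz unfolding a_def by metis
    obtain e2 where e2: "e2 > 0" "\<And>x. x \<in> ball z e2 \<Longrightarrow> m \<bullet> x \<le> b2 \<Longrightarrow> x \<in> K2"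
      using half_ball_at_facet[OF conv(2) int(2) sub(2) _ n2(2,3) z] nz unfolding m_def by metis
    have "ball z (min e1 e2) \<subseteq> K1 \<union> K2"
    proof
      fix x assume x: "x \<in> ball z (min e1 e2)"
      show "x \<in> K1 \<union> K2"
        using x e1(2)[of x] e2(2)[of x] b2 \<open>m = - a\<close> by (cases "a \<bullet> x \<le> b1") auto
    qed
    then show "z \<in> interior (K1 \<union> K2)" using e1(1) e2(1) by (auto simp: mem_interior intro!: exI[of _ "min e1 e2"])
  qed
qed

text \<open>In a triangulation the intersection of two elements is a face of both. If it contains a relative
  interior point of a facet it contains the facet, and there is no room for a larger proper face.\<close>

lemma facet_of_other_element:
  fixes K K' :: "(real^'n) set"
  assumes M: "triangulation M" "K \<in> M" "K' \<in> M" "K \<noteq> K'"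
    and int: "interior K \<noteq> {}" "interior K' \<noteq> {}"
    and F: "F facet_of K" and y0: "y0 \<in> rel_interior F" "y0 \<in> K'"
  shows "F facet_of K'"
proof -
  have conv: "convex K" "convex K'"
    using M simplex_imp_polytope polytope_imp_convex unfolding triangulation_def by blast+
  have face: "(K \<inter> K') face_of K" "(K \<inter> K') face_of K'"
    using M unfolding triangulation_def by (metis inf_commute)+
  have FK: "F face_of K" "F \<noteq> {}" "aff_dim F = aff_dim K - 1" "F \<subseteq> K"
    using F facet_of_imp_subset by (auto simp: facet_of_def)
  have "y0 \<in> K" using y0(1) FK(4) rel_interior_subset by blast
  then have sub: "F \<subseteq> K \<inter> K'" using subset_of_face_of[OF face(1) FK(4)] y0 by blast
  have ne: "K \<inter> K' \<noteq> K"
  proof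
    assume e: "K \<inter> K' = K"
    then have "K = K'" using face_with_interior_eq[OF conv(2), of K] face(2) int(1) by simp
    then show False using M(4) by simp
  qed
  have "F face_of (K \<inter> K')" using FK(1) sub face_of_subset by blast
  moreover have "\<not> aff_dim F < aff_dim (K \<inter> K')"
    using face_of_aff_dim_lt[OF conv(1) face(1) ne] FK(3) by linarith
  ultimately have "F = K \<inter> K'"
    using face_of_aff_dim_lt[of "K \<inter> K'" F] conv convex_Int by blast
  moreover have "aff_dim K = aff_dim K'" using int by (simp add: aff_dim_nonempty_interior)
  ultimately show ?thesis using face(2) FK by (simp add: facet_of_def)
qed

section \<open>Elements and facets of a simplicial mesh\<close>

lemma facets_on_iff: "F \<in> facets_on M \<Gamma> \<longleftrightarrow> F \<in> facets M \<and> rel_interior F \<subseteq> \<Gamma>"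
  by (simp add: facets_on_def)

lemma mesh_element:
  fixes M :: "(real^'n) set set"
  assumes "simplicial_mesh M S" "K \<in> M"
  shows "polytope K" "compact K" "convex K" "interior K \<noteq> {}"
proof -
  have K: "int CARD('n) simplex K" using assms by (auto simp: simplicial_mesh_def)
  show 1: "polytope K" using simplex_imp_polytope[OF K] .
  then show "compact K" "convex K" by (auto simp: polytope_imp_compact polytope_imp_convex)
  have d: "aff_dim K = int DIM(real^'n)" using aff_dim_simplex[OF K] by simp
  then have "rel_interior K = interior K" using interior_rel_interior_gen[of K] by simp
  moreover have "K \<noteq> {}" using d by auto
  ultimately show "interior K \<noteq> {}"
    using rel_interior_eq_empty[OF \<open>convex K\<close>] by simp
qed

lemma mesh_finite: "simplicial_mesh M S \<Longrightarrow> finite M"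
  by (simp add: simplicial_mesh_def triangulation_def)

lemma facet_geometry:
  fixes M :: "(real^'n) set set"
  assumes "simplicial_mesh M S" "K \<in> M" "F facet_of K"
  shows "F \<in> facets M" "compact F" "convex F" "rel_interior F \<noteq> {}" "F \<subseteq> K"
proof -
  show "F \<in> facets M" using assms by (auto simp: facets_def)
  show "convex F" using assms(3) by (auto simp: facet_of_def face_of_def)
  show "compact F"
    using mesh_element[OF assms(1,2)] assms(3) face_of_imp_compact facet_of_imp_face_of by blast
  show "rel_interior F \<noteq> {}" using \<open>convex F\<close> assms(3) by (auto simp: facet_of_def rel_interior_eq_empty)
  show "F \<subseteq> K" using assms(3) by (rule facet_of_imp_subset)
qed

lemma facetsE:
  assumes "F \<in> facets M"
  obtains K where "K \<in> M" "F facet_of K"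
  using assms by (auto simp: facets_def)

lemma mesh_facet:
  assumes "simplicial_mesh M S" "F \<in> facets M"
  shows "compact F" "convex F" "rel_interior F \<noteq> {}"
  using assms facet_geometry by (metis facetsE)+

lemma finite_facets_of_element: "simplicial_mesh M S \<Longrightarrow> K \<in> M \<Longrightarrow> finite {F. F facet_of K}"
  using mesh_element(1) finite_polytope_facets by blast

lemma finite_facets:
  assumes "simplicial_mesh M S"
  shows "finite (facets M)"
proof -
  have "facets M = (\<Union>K\<in>M. {F. F facet_of K})" by (auto simp: facets_def)
  then show ?thesis using assms mesh_finite finite_facets_of_element by fastforce
qed

lemma outward_normal_norm:
  assumes "simplicial_mesh M S" "K \<in> M" "F facet_of K"
  shows "norm (outward_normal K F) = 1"
  using outward_normal_supports[OF mesh_element(1,4)[OF assms(1,2)] assms(3)] by metis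

lemma polyhedral_open_interior_closure: "polyhedral_open S \<Longrightarrow> interior (closure S) = S"
  by (simp add: polyhedral_open_def)

lemma polyhedral_open_frontier: "polyhedral_open S \<Longrightarrow> S \<inter> frontier S = {}"
  by (metis Diff_disjoint frontier_def interior_interior polyhedral_open_interior_closure)

text \<open>An element does not reach across its facet, so a neighbourhood of a facet in the interior of the
  domain is covered only with the help of a second element; a third one would have an outward
  normal opposite to two opposite vectors.\<close>

lemma interior_facet_elements:
  fixes M :: "(real^'n) set set"
  assumes M: "simplicial_mesh M S" and S: "polyhedral_open S" and F: "F \<in> facets_on M S"
  obtains K K' where "{K \<in> M. F facet_of K} = {K, K'}" "K \<noteq> K'"
    "outward_normal K' F = - outward_normal K F"
proof -
  have tri: "triangulation M" and un: "\<Union>M = closure S" using M by (auto simp: simplicial_mesh_def)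
  obtain K where K: "K \<in> M" "F facet_of K" using F by (auto simp: facets_on_iff elim: facetsE)
  note intK = mesh_element(4)[OF M]
  obtain y0 where y0: "y0 \<in> rel_interior F" using facet_geometry(4)[OF M K] by blast
  \<comment> \<open>Otherwise \<open>y0\<close> would be interior to \<open>K\<close>, although moving along the outward normal leaves \<open>K\<close>.\<close>
  have "y0 \<in> \<Union>(M - {K})"
  proof (rule ccontr)
    assume "y0 \<notin> \<Union>(M - {K})"
    moreover have "closed (\<Union>(M - {K}))"
      using mesh_finite[OF M] mesh_element(2)[OF M] by (intro closed_Union) (auto intro: compact_imp_closed)
    moreover have "y0 \<in> S" using F y0 by (auto simp: facets_on_iff)
    then have "y0 \<in> interior (\<Union>M)" using polyhedral_open_interior_closure[OF S] un by simp
    ultimately have "y0 \<in> interior (\<Union>M) \<inter> - \<Union>(M - {K})" "open (interior (\<Union>M) \<inter> - \<Union>(M - {K}))"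
      by (auto intro!: open_Int open_Compl)
    moreover have "interior (\<Union>M) \<inter> - \<Union>(M - {K}) \<subseteq> K" using interior_subset by auto
    ultimately have "y0 \<in> interior K" using interior_maximal by blast
    then obtain e where e: "e > 0" "ball y0 e \<subseteq> K" by (auto simp: mem_interior)
    obtain b where b: "\<And>x. x \<in> K \<Longrightarrow> outward_normal K F \<bullet> x \<le> b"
        "affine hull F = {x. outward_normal K F \<bullet> x = b}"
      using outward_normal_supports[OF mesh_element(1,4)[OF M K(1)] K(2)] by metis
    have n1: "norm (outward_normal K F) = 1" using outward_normal_norm[OF M K] .
    have "y0 \<in> affine hull F" using y0 by (metis hull_inc rel_interior_subset subsetD)
    then have yb: "outward_normal K F \<bullet> y0 = b" using b(2) by blast
    have "dist y0 (y0 + (e/2) *\<^sub>R outward_normal K F) = e / 2" using e n1 by (simp add: dist_norm)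
    then have "y0 + (e/2) *\<^sub>R outward_normal K F \<in> K" using e by (intro subsetD[OF e(2)]) auto
    then have "b + e/2 \<le> b" using b(1) yb n1 by (force simp: inner_add_right dot_square_norm)
    then show False using e by simp
  qed
  then obtain K' where K': "K' \<in> M" "K' \<noteq> K" "y0 \<in> K'" by blast
  have FK': "F facet_of K'"
    by (rule facet_of_other_element[OF tri K(1) K'(1) K'(2)[symmetric] intK intK K(2) y0 K'(3)])
      (use K K' in auto)
  note opp = two_elements_at_facet(1)[OF tri _ _ _ intK intK]
  have nK': "outward_normal K' F = - outward_normal K F"
    using opp[of K K'] K K' FK' by auto
  have "L = K \<or> L = K'" if L: "L \<in> M" "F facet_of L" for L
  proof (rule ccontr)
    assume "\<not> (L = K \<or> L = K')"
    then have "outward_normal L F = - outward_normal K F" "outward_normal L F = - outward_normal K' F"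
      using opp[of K L] opp[of K' L] K K' FK' L by auto
    then have "outward_normal K F = - outward_normal K F" using nK' by simp
    then have "outward_normal K F = 0" by (simp add: eq_neg_iff_add_eq_0 scaleR_2[symmetric])
    then show False using outward_normal_norm[OF M K] by simp
  qed
  then have "{K \<in> M. F facet_of K} = {K, K'}" using K K' FK' by auto
  then show ?thesis using that K' nK' by metis
qed

lemma boundary_facet_element:
  assumes M: "simplicial_mesh M S" and S: "polyhedral_open S"
    and F: "F \<in> facets M" "rel_interior F \<subseteq> frontier S"
  shows "\<exists>K. {K \<in> M. F facet_of K} = {K} \<and> bdry_element M F = K"
proof -
  have tri: "triangulation M" and un: "\<Union>M = closure S" using M by (auto simp: simplicial_mesh_def)
  obtain K where K: "K \<in> M" "F facet_of K" using F by (elim facetsE)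
  have uniq: "L = K" if L: "L \<in> M" "F facet_of L" for L
  proof (rule ccontr)
    assume "L \<noteq> K"
    then have "rel_interior F \<subseteq> interior (K \<union> L)"
      using two_elements_at_facet(2)[OF tri K(1) L(1) _ _ _ K(2) L(2)] mesh_element(4)[OF M] K L by auto
    also have "\<dots> \<subseteq> S"
      using K L un polyhedral_open_interior_closure[OF S] interior_mono[of "K \<union> L" "closure S"] by auto
    finally show False
      using F(2) polyhedral_open_frontier[OF S] facet_geometry(4)[OF M K] by blast
  qed
  have "bdry_element M F = K" unfolding bdry_element_def by (rule the_equality) (use K uniq in blast)+
  moreover have "{L \<in> M. F facet_of L} = {K}" using K uniq by blast
  ultimately show ?thesis by (intro exI[of _ K] conjI)
qed

section \<open>Integrals over elements and facets\<close>

lemma set_integrable_continuous_compact: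
  fixes f :: "'a::euclidean_space \<Rightarrow> real"
  assumes M: "sets borel \<subseteq> sets M" "space M = UNIV" and S: "compact S" "emeasure M S < \<infinity>"
    and f: "continuous_on S f"
  shows "set_integrable M S f"
proof -
  have "bounded (f ` S)" using S f compact_continuous_image compact_imp_bounded by blast
  then obtain B where B: "\<And>x. x \<in> S \<Longrightarrow> norm (f x) \<le> B" by (auto simp: bounded_iff)
  have S': "S \<in> sets borel" using S(1) by (simp add: borel_compact)
  have "(\<lambda>x. indicator S x *\<^sub>R f x) \<in> borel_measurable borel"
    using borel_measurable_continuous_on_indicator[OF S' f] .
  then have "(\<lambda>x. indicator S x *\<^sub>R f x) \<in> borel_measurable M"
    using M by (auto simp: measurable_def)
  then show ?thesis
    unfolding set_integrable_def using S' M S(2) B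
    by (intro integrableI_bounded_set[where A=S and B=B]) (auto simp: indicator_def)
qed

lemma element_measure_finite:
  fixes K :: "(real^'n) set"
  assumes "compact K"
  shows "emeasure lebesgue K < \<infinity>"
  using emeasure_compact_finite[OF assms] borel_compact[OF assms] by simp

lemma set_integrable_element:
  fixes f :: "real^'n \<Rightarrow> real"
  assumes "compact K" "continuous_on K f"
  shows "set_integrable lebesgue K f"
proof (rule set_integrable_continuous_compact[OF _ _ assms(1) _ assms(2)])
  show "emeasure lebesgue K < \<infinity>" using assms(1) by (rule element_measure_finite)
qed auto

text \<open>The integral of the square can vanish only with the function, because a continuous function
  which is nonzero at a point is bounded away from zero on a piece of positive measure.\<close>

lemma square_integral_zero_imp_zero:
  fixes f :: "'a::euclidean_space \<Rightarrow> real"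
  assumes M: "sets borel \<subseteq> sets M" "space M = UNIV" and S: "compact S" "emeasure M S < \<infinity>"
    and f: "continuous_on S f"
    and pos: "\<And>x e. x \<in> S \<Longrightarrow> e > 0 \<Longrightarrow> emeasure M (S \<inter> ball x e) \<noteq> 0"
    and zero: "(LINT x:S|M. f x * f x) = 0" and x: "x \<in> S"
  shows "f x = 0"
proof (rule ccontr)
  assume fx: "f x \<noteq> 0"
  have cont2: "continuous_on S (\<lambda>x. f x * f x)" by (intro continuous_intros f)
  have "integrable M (\<lambda>x. indicator S x *\<^sub>R (f x * f x))"
    using set_integrable_continuous_compact[OF M S cont2] by (simp add: set_integrable_def)
  moreover have "integral\<^sup>L M (\<lambda>x. indicator S x *\<^sub>R (f x * f x)) = 0"
    using zero by (simp add: set_lebesgue_integral_def)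
  ultimately have "AE y in M. indicator S y *\<^sub>R (f y * f y) = 0"
    using integral_nonneg_eq_0_iff_AE[of M "\<lambda>x. indicator S x *\<^sub>R (f x * f x)"] by simp
  obtain e where e: "e > 0" "\<And>y. y \<in> S \<Longrightarrow> dist y x < e \<Longrightarrow> dist (f y) (f x) < \<bar>f x\<bar>"
    using f x fx unfolding continuous_on_iff by (metis zero_less_abs_iff)
  then have "f y \<noteq> 0" if "y \<in> S \<inter> ball x e" for y
    using that e(2)[of y] by (auto simp: dist_commute dist_real_def)
  then have "AE y in M. y \<notin> S \<inter> ball x e"
    using \<open>AE y in M. indicator S y *\<^sub>R (f y * f y) = 0\<close>
    by (auto elim!: eventually_mono)
  moreover have "S \<inter> ball x e \<in> sets M"
    by (rule subsetD[OF M(1)]) (intro sets.Int borel_open borel_compact S(1) open_ball)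
  ultimately have "emeasure M (S \<inter> ball x e) = 0"
    using M(2) by (subst (asm) AE_iff_measurable[where N = "S \<inter> ball x e"]) auto
  then show False using pos x e(1) by blast
qed

lemma emeasure_open_pos:
  fixes U :: "'a::euclidean_space set"
  assumes "open U" "U \<noteq> {}"
  shows "emeasure lborel U \<noteq> 0"
proof
  assume "emeasure lborel U = 0"
  then have "U \<in> null_sets lborel" using assms by (auto intro: null_setsI)
  then have "negligible U" by (simp add: negligible_iff_null_sets null_sets_completionI)
  then show False using open_not_negligible[OF assms] by simp
qed

lemma element_square_integral_zero:
  fixes f :: "real^'n \<Rightarrow> real"
  assumes K: "compact K" "convex K" "interior K \<noteq> {}" and f: "continuous_on K f"
    and zero: "(LINT x:K|lebesgue. f x * f x) = 0" and x: "x \<in> K"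
  shows "f x = 0"
proof (rule square_integral_zero_imp_zero[OF _ _ K(1) _ f _ zero x])
  show "emeasure lebesgue K < \<infinity>" using K(1) by (rule element_measure_finite)
  show "emeasure lebesgue (K \<inter> ball y e) \<noteq> 0" if "y \<in> K" "e > 0" for y e
  proof -
    have "y \<in> closure (interior K)" using convex_closure_interior[OF K(2,3)] that closure_subset by blast
    then have "interior K \<inter> ball y e \<noteq> {}"
      using that by (force simp: closure_approachable dist_commute)
    then have "emeasure lborel (interior K \<inter> ball y e) \<noteq> 0" by (intro emeasure_open_pos) auto
    moreover have "emeasure lborel (interior K \<inter> ball y e) \<le> emeasure lborel (K \<inter> ball y e)"
      using K(1) interior_subset by (intro emeasure_mono) (auto intro: borel_compact)
    moreover have "K \<inter> ball y e \<in> sets borel" by (intro sets.Int borel_open borel_compact K(1) open_ball)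
    ultimately show ?thesis by auto
  qed
qed auto

lemma sets_facet_measure: "sets (facet_measure F) = sets borel" "space (facet_measure F) = UNIV"
  by (auto simp: facet_measure_def)

text \<open>The measure of \<open>A\<close> is a Lebesgue measure of a preimage under the nearest-point projection, which
  is continuous; in this form finiteness and positivity can be read off from volumes.\<close>

lemma emeasure_facet_measure:
  assumes F: "F \<noteq> {}" and A: "A \<in> sets borel"
  shows "emeasure (facet_measure F) A =
    emeasure lborel ({y. infdist y (affine hull F) \<le> 1/2} \<inter> closest_point (affine hull F) -` A)"
    and "{y. infdist y (affine hull F) \<le> 1/2} \<inter> closest_point (affine hull F) -` A \<in> sets borel"
proof -
  define H where "H = affine hull F"
  have H: "convex H" "closed H" "H \<noteq> {}" using F by (auto simp: H_def affine_imp_convex)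
  have cp: "closest_point H \<in> borel_measurable borel"
    using continuous_on_closest_point[OF H] by (rule borel_measurable_continuous_onI)
  have "closed {y. infdist y H \<le> 1/2}" by (intro closed_Collect_le continuous_intros)
  then have slab: "{y. infdist y H \<le> 1/2} \<in> sets borel" by (rule borel_closed)
  have pre: "closest_point H -` A \<in> sets borel" using measurable_sets[OF cp A] by simp
  then show "{y. infdist y (affine hull F) \<le> 1/2} \<inter> closest_point (affine hull F) -` A \<in> sets borel"
    using slab unfolding H_def by blast
  have "emeasure (facet_measure F) A = emeasure (restrict_space lborel {y. infdist y H \<le> 1/2})
      (closest_point H -` A \<inter> {y. infdist y H \<le> 1/2})"
    unfolding facet_measure_def H_def[symmetric] using A cp slab
    by (subst emeasure_distr) (auto simp: space_restrict_space intro: measurable_restrict_space1)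
  also have "\<dots> = emeasure lborel (closest_point H -` A \<inter> {y. infdist y H \<le> 1/2})"
    using slab by (intro emeasure_restrict_space) auto
  finally show "emeasure (facet_measure F) A =
    emeasure lborel ({y. infdist y (affine hull F) \<le> 1/2} \<inter> closest_point (affine hull F) -` A)"
    by (simp add: H_def Int_commute)
qed

lemma facet_measure_finite:
  assumes "compact F"
  shows "emeasure (facet_measure F) F < \<infinity>"
proof (cases "F = {}")
  case False
  define H where "H = affine hull F"
  have H: "closed H" "H \<noteq> {}" using False by (auto simp: H_def)
  obtain B where B: "\<And>x. x \<in> F \<Longrightarrow> norm x \<le> B"
    using compact_imp_bounded[OF assms] by (auto simp: bounded_iff)
  have "norm y \<le> B + 1/2" if "infdist y H \<le> 1/2" "closest_point H y \<in> F" for y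
  proof -
    have "dist y (closest_point H y) = infdist y H"
      using H by (simp add: infdist_eq_setdist setdist_closest_point)
    then have "norm (y - closest_point H y) \<le> 1/2" using that by (simp add: dist_norm)
    then show ?thesis using B[OF that(2)] norm_triangle_sub[of y "closest_point H y"] by linarith
  qed
  then have "bounded ({y. infdist y H \<le> 1/2} \<inter> closest_point H -` F)"
    by (auto simp: bounded_iff)
  then show ?thesis
    using emeasure_bounded_finite emeasure_facet_measure(1)[OF False borel_compact[OF assms]]
    by (simp add: H_def)
qed simp

text \<open>The nearest-point projection is nonexpansive, so a small ball about a relative interior point of
  \<open>F\<close> lies in the prism above the corresponding piece of \<open>F\<close>.\<close>

lemma facet_measure_pos:
  assumes F: "compact F" "convex F" and x: "x \<in> F" and e: "e > 0"
  shows "emeasure (facet_measure F) (F \<inter> ball x e) \<noteq> 0"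
proof -
  define H where "H = affine hull F"
  have F0: "F \<noteq> {}" using x by blast
  have H: "convex H" "closed H" "H \<noteq> {}" using F0 by (auto simp: H_def affine_imp_convex)
  have "x \<in> closure (rel_interior F)" using convex_closure_rel_interior[OF F(2)] x closure_subset by blast
  then obtain y where y: "y \<in> rel_interior F" "dist y x < e" using e by (auto simp: closure_approachable)
  obtain d where d: "d > 0" "ball y d \<inter> H \<subseteq> F" using y(1) by (auto simp: mem_rel_interior_ball H_def)
  have yH: "y \<in> H" using y(1) unfolding H_def by (metis hull_inc rel_interior_subset subsetD)
  \<comment> \<open>The radius keeps the ball in the slab of half-width \<open>1/2\<close> and its projection in \<open>F\<close> and near \<open>x\<close>.\<close>
  define r where "r = min (min d (1/2)) (e - dist y x)"
  have r: "r > 0" "r \<le> d" "r \<le> 1/2" "r \<le> e - dist y x" unfolding r_def using d y by linarith+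
  have "ball y r \<subseteq> {y. infdist y H \<le> 1/2} \<inter> closest_point H -` (F \<inter> ball x e)"
  proof
    fix z assume z: "z \<in> ball y r"
    have "infdist z H \<le> dist z y" using yH by (rule infdist_le)
    moreover have "dist (closest_point H y) (closest_point H z) \<le> dist y z"
      by (rule closest_point_lipschitz[OF H])
    then have cz: "dist y (closest_point H z) < r" using yH z by (simp add: closest_point_self)
    moreover have "closest_point H z \<in> H" using H by (simp add: closest_point_in_set)
    moreover have "dist x (closest_point H z) < e"
      using dist_triangle[of x "closest_point H z" y] cz r by (simp add: dist_commute)
    ultimately show "z \<in> {y. infdist y H \<le> 1/2} \<inter> closest_point H -` (F \<inter> ball x e)"
      using z r d(2) by (auto simp: dist_commute)
  qed
  moreover have "F \<inter> ball x e \<in> sets borel" by (intro sets.Int borel_open borel_compact F(1) open_ball)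
  note em = emeasure_facet_measure[OF F0 this, folded H_def]
  ultimately have "emeasure lborel (ball y r) \<le> emeasure (facet_measure F) (F \<inter> ball x e)"
    unfolding em(1) using em(2) by (intro emeasure_mono) auto
  moreover have "emeasure lborel (ball y r) \<noteq> 0" using r by (intro emeasure_open_pos) auto
  ultimately show ?thesis by auto
qed

lemma set_integrable_facet:
  fixes f :: "real^'n \<Rightarrow> real"
  assumes "compact F" "continuous_on F f"
  shows "set_integrable (facet_measure F) F f"
  using assms(1) facet_measure_finite[OF assms(1)] assms(2)
  by (rule set_integrable_continuous_compact[rotated 2]) (simp_all add: sets_facet_measure)

lemma facet_square_integral_zero:
  fixes f :: "real^'n \<Rightarrow> real"
  assumes F: "compact F" "convex F" and f: "continuous_on F f"
    and zero: "(LINT x:F|facet_measure F. f x * f x) = 0" and x: "x \<in> F"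
  shows "f x = 0"
proof (rule square_integral_zero_imp_zero[OF _ _ F(1) _ f _ zero x])
  show "emeasure (facet_measure F) F < \<infinity>" using F(1) by (rule facet_measure_finite)
  show "emeasure (facet_measure F) (F \<inter> ball y e) \<noteq> 0" if "y \<in> F" "e > 0" for y e
    using facet_measure_pos[OF F that] .
qed (simp_all add: sets_facet_measure)

lemma elem_integral_add:
  assumes "simplicial_mesh M S"
    and "\<And>K. K \<in> M \<Longrightarrow> continuous_on K (f K)" "\<And>K. K \<in> M \<Longrightarrow> continuous_on K (g K)"
  shows "elem_integral M (\<lambda>K x. f K x + g K x) = elem_integral M f + elem_integral M g"
  unfolding elem_integral_def sum.distrib[symmetric]
  by (intro sum.cong refl set_integral_add(2) set_integrable_element mesh_element(2)[OF assms(1)]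
      assms(2,3))

lemma elem_integral_diff:
  assumes "simplicial_mesh M S"
    and "\<And>K. K \<in> M \<Longrightarrow> continuous_on K (f K)" "\<And>K. K \<in> M \<Longrightarrow> continuous_on K (g K)"
  shows "elem_integral M (\<lambda>K x. f K x - g K x) = elem_integral M f - elem_integral M g"
  unfolding elem_integral_def sum_subtractf[symmetric]
  by (intro sum.cong refl set_integral_diff(2) set_integrable_element mesh_element(2)[OF assms(1)]
      assms(2,3))

lemma elem_integral_square_zero:
  assumes M: "simplicial_mesh M S" and f: "\<And>K. K \<in> M \<Longrightarrow> continuous_on K (f K)"
    and zero: "elem_integral M (\<lambda>K x. f K x * f K x) = 0" and K: "K \<in> M" "x \<in> K"
  shows "f K x = 0"
proof -
  have "(LINT x:K|lebesgue. f K x * f K x) \<ge> 0" for K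
    unfolding set_lebesgue_integral_def by (intro Bochner_Integration.integral_nonneg) simp
  then have "(LINT x:K|lebesgue. f K x * f K x) = 0"
    using zero K(1) mesh_finite[OF M] unfolding elem_integral_def
    by (subst (asm) sum_nonneg_eq_0_iff) blast+
  then show ?thesis using element_square_integral_zero[OF mesh_element(2-4)[OF M K(1)] f[OF K(1)] _ K(2)] by blast
qed

lemma facet_integral_square_zero:
  assumes M: "simplicial_mesh M S" and f: "\<And>F. F \<in> facets M \<Longrightarrow> continuous_on F (f F)"
    and zero: "facet_integral (facets M) (\<lambda>F x. f F x * f F x) = 0" and F: "F \<in> facets M" "x \<in> F"
  shows "f F x = 0"
proof -
  have "(LINT x:F|facet_measure F. f F x * f F x) \<ge> 0" for F
    unfolding set_lebesgue_integral_def by (intro Bochner_Integration.integral_nonneg) simp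
  then have "(LINT x:F|facet_measure F. f F x * f F x) = 0"
    using zero F(1) finite_facets[OF M] unfolding facet_integral_def
    by (subst (asm) sum_nonneg_eq_0_iff) blast+
  then show ?thesis using facet_square_integral_zero[OF mesh_facet(1,2)[OF M F(1)] f[OF F(1)] _ F(2)] by blast
qed

text \<open>A facet function takes the same value from all elements at the facet. Exchanging the two sums
  therefore leaves, at each facet, one integral against the sum of the element contributions;
  this sum is where jumps come from.\<close>

lemma bdry_integral_by_facets:
  assumes M: "simplicial_mesh M S" and q: "\<And>F. F \<in> facets M \<Longrightarrow> continuous_on F (q F)"
    and \<psi>: "\<And>K F. K \<in> M \<Longrightarrow> F facet_of K \<Longrightarrow> continuous_on F (\<psi> K F)"
  shows "bdry_integral M (\<lambda>K F x. q F x * \<psi> K F x) =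
    facet_integral (facets M) (\<lambda>F x. q F x * (\<Sum>K | K \<in> M \<and> F facet_of K. \<psi> K F x))"
proof -
  have "bdry_integral M (\<lambda>K F x. q F x * \<psi> K F x) =
      (\<Sum>K\<in>M. \<Sum>F | F \<in> facets M \<and> F facet_of K. LINT x:F|facet_measure F. q F x * \<psi> K F x)"
    unfolding bdry_integral_def by (intro sum.cong) (auto simp: facets_def)
  also have "\<dots> = (\<Sum>F\<in>facets M. \<Sum>K | K \<in> M \<and> F facet_of K.
      LINT x:F|facet_measure F. q F x * \<psi> K F x)"
    by (rule sum.swap_restrict[OF mesh_finite[OF M] finite_facets[OF M]])
  also have "\<dots> = (\<Sum>F\<in>facets M. LINT x:F|facet_measure F.
      (\<Sum>K | K \<in> M \<and> F facet_of K. q F x * \<psi> K F x))"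
  proof (rule sum.cong[OF refl])
    fix F assume F: "F \<in> facets M"
    have "set_integrable (facet_measure F) F (\<lambda>x. q F x * \<psi> K F x)" if "K \<in> M \<and> F facet_of K" for K
      using that F q \<psi> mesh_facet[OF M F]
      by (intro set_integrable_facet) (auto intro!: continuous_intros)
    then show "(\<Sum>K | K \<in> M \<and> F facet_of K. LINT x:F|facet_measure F. q F x * \<psi> K F x) =
        (LINT x:F|facet_measure F. \<Sum>K | K \<in> M \<and> F facet_of K. q F x * \<psi> K F x)"
      using mesh_finite[OF M]
      unfolding set_lebesgue_integral_def set_integrable_def
      by (simp only: scaleR_sum_right) (rule Bochner_Integration.integral_sum[symmetric], simp)
  qed
  finally show ?thesis by (simp add: facet_integral_def sum_distrib_left)
qed

section \<open>Functions annihilated by a discrete space\<close>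

lemma Vh_divergence: "v \<in> Vh k M \<Longrightarrow> (\<lambda>K. divergence (v K)) \<in> Qh k M"
  using divergence_polys unfolding Vh_def Qh_def by blast

lemma Qh_continuous: "q \<in> Qh k M \<Longrightarrow> K \<in> M \<Longrightarrow> continuous_on S (q K)"
  using polys_continuous unfolding Qh_def by blast

lemma Qh_add: "p \<in> Qh k M \<Longrightarrow> q \<in> Qh k M \<Longrightarrow> (\<lambda>K x. p K x + q K x) \<in> Qh k M"
  by (simp add: Qh_def polys_add)

lemma Qh_diff: "p \<in> Qh k M \<Longrightarrow> q \<in> Qh k M \<Longrightarrow> (\<lambda>K x. p K x - q K x) \<in> Qh k M"
  by (simp add: Qh_def polys_diff)

lemma Qh_cmult: "q \<in> Qh k M \<Longrightarrow> (\<lambda>K x. s * q K x) \<in> Qh k M"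
  by (simp add: Qh_def polys_cmult)

lemma Qh_time_diff: "p \<in> Qh k M \<Longrightarrow> q \<in> Qh k M \<Longrightarrow> time_diff \<Delta>t p q \<in> Qh k M"
  using Qh_cmult[OF Qh_diff, of p k M q "1 / \<Delta>t"] by (simp add: time_diff_def[abs_def])

text \<open>The function \<open>r\<close> may be tested with itself, and the sum of the squared \<open>L\<^sup>2\<close>-norms then vanishes
  term by term.\<close>

lemma Qh_orthogonal_zero:
  assumes "simplicial_mesh M S" "r \<in> Qh k M"
    and "\<And>q. q \<in> Qh k M \<Longrightarrow> elem_integral M (\<lambda>K x. r K x * q K x) = 0"
    and "K \<in> M" "x \<in> K"
  shows "r K x = 0"
proof (rule elem_integral_square_zero[where f = r, OF assms(1) _ _ assms(4,5)])
  show "continuous_on K (r K)" if "K \<in> M" for K using Qh_continuous[OF assms(2) that] .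
  show "elem_integral M (\<lambda>K x. r K x * r K x) = 0" using assms(3)[OF assms(2)] .
qed

text \<open>The projection is determined on the elements by its moments, and \<open>h\<close>, which has these moments,
  is at the same time the witness that a projection exists.\<close>

lemma L2_projection_eq:
  assumes M: "simplicial_mesh M S" and h: "h \<in> Qh k M"
    and moments: "\<And>q. q \<in> Qh k M \<Longrightarrow>
      elem_integral M (\<lambda>K x. h K x * q K x) = elem_integral M (\<lambda>K x. g x * q K x)"
    and K: "K \<in> M" "x \<in> K"
  shows "L2_projection k M g K x = h K x"
proof -
  let ?P = "L2_projection k M g"
  have "?P \<in> Qh k M \<and> (\<forall>q\<in>Qh k M. (\<Sum>K\<in>M. LINT x:K|lebesgue. ?P K x * q K x) =
      (\<Sum>K\<in>M. LINT x:K|lebesgue. g x * q K x))"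
    unfolding L2_projection_def by (rule someI[of _ h]) (use h moments in \<open>auto simp: elem_integral_def\<close>)
  then have P: "?P \<in> Qh k M" and Pm: "\<And>q. q \<in> Qh k M \<Longrightarrow>
      elem_integral M (\<lambda>K x. ?P K x * q K x) = elem_integral M (\<lambda>K x. g x * q K x)"
    by (auto simp: elem_integral_def)
  have "?P K x - h K x = 0"
  proof (rule Qh_orthogonal_zero[OF M Qh_diff[OF P h] _ K])
    fix q :: "('a, real) broken" assume q: "q \<in> Qh k M"
    have "elem_integral M (\<lambda>K x. (?P K x - h K x) * q K x) =
        elem_integral M (\<lambda>K x. ?P K x * q K x) - elem_integral M (\<lambda>K x. h K x * q K x)"
      unfolding left_diff_distrib
      by (rule elem_integral_diff[OF M]; intro continuous_on_mult Qh_continuous[OF P]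
          Qh_continuous[OF h] Qh_continuous[OF q])
    then show "elem_integral M (\<lambda>K x. (?P K x - h K x) * q K x) = 0"
      using Pm[OF q] moments[OF q] by simp
  qed
  then show ?thesis by simp
qed

definition facet_poly :: "nat \<Rightarrow> (real^'n) set \<Rightarrow> (real^'n \<Rightarrow> real) \<Rightarrow> bool" where
  "facet_poly k F r \<longleftrightarrow> (\<exists>p\<in>polys k. \<forall>x\<in>F. r x = p x)"

lemma facet_poly_continuous:
  assumes "facet_poly k F r"
  shows "continuous_on F r"
proof -
  obtain p where p: "p \<in> polys k" "\<And>x. x \<in> F \<Longrightarrow> r x = p x"
    using assms unfolding facet_poly_def by blast
  show ?thesis by (rule continuous_on_eq[OF polys_continuous[OF p(1)] p(2)[symmetric]])
qed

lemma facet_poly_of_poly: "r \<in> polys k \<Longrightarrow> facet_poly k F r"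
  by (auto simp: facet_poly_def)

lemma facet_poly_lincomb:
  assumes "facet_poly k F r" "facet_poly k F s"
  shows "facet_poly k F (\<lambda>x. c * r x + d * s x)"
proof -
  obtain p q where p: "p \<in> polys k" "\<forall>x\<in>F. r x = p x" and q: "q \<in> polys k" "\<forall>x\<in>F. s x = q x"
    using assms unfolding facet_poly_def by blast
  have "\<forall>x\<in>F. c * r x + d * s x = c * p x + d * q x" using p(2) q(2) by simp
  with polys_lincomb[OF p(1) q(1)] show ?thesis
    unfolding facet_poly_def by (intro bexI[where x = "\<lambda>x. c * p x + d * q x"])
qed

lemma facet_poly_add: "facet_poly k F r \<Longrightarrow> facet_poly k F s \<Longrightarrow> facet_poly k F (\<lambda>x. r x + s x)"
  using facet_poly_lincomb[of k F r s 1 1] by simp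

lemma facet_poly_diff: "facet_poly k F r \<Longrightarrow> facet_poly k F s \<Longrightarrow> facet_poly k F (\<lambda>x. r x - s x)"
  using facet_poly_lincomb[of k F r s 1 "-1"] by simp

lemma facet_poly_cmult: "facet_poly k F r \<Longrightarrow> facet_poly k F (\<lambda>x. c * r x)"
  using facet_poly_lincomb[of k F r r c 0] by simp

lemma facet_poly_sum:
  assumes "\<And>i. i \<in> I \<Longrightarrow> facet_poly k F (r i)"
  shows "facet_poly k F (\<lambda>x. \<Sum>i\<in>I. r i x)"
proof -
  have "\<forall>i\<in>I. \<exists>p. p \<in> polys k \<and> (\<forall>x\<in>F. r i x = p x)"
    using assms unfolding facet_poly_def by blast
  from bchoice[OF this] obtain p where p: "\<And>i. i \<in> I \<Longrightarrow> p i \<in> polys k"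
      "\<And>i x. i \<in> I \<Longrightarrow> x \<in> F \<Longrightarrow> r i x = p i x" by blast
  have "\<forall>x\<in>F. (\<Sum>i\<in>I. r i x) = (\<Sum>i\<in>I. p i x)" using p(2) by simp
  with polys_sum[of I p k, OF p(1)] show ?thesis
    unfolding facet_poly_def by (intro bexI[where x = "\<lambda>x. \<Sum>i\<in>I. p i x"])
qed

lemma facet_poly_inner_Vbar:
  assumes "v \<in> Vbar k M \<Gamma>" "F \<in> facets M"
  shows "facet_poly k F (\<lambda>x. v F x \<bullet> m)"
proof -
  obtain p where "p \<in> vpolys k" "\<forall>x\<in>F. v F x = p x" using assms by (auto simp: Vbar_def)
  then show ?thesis using vpolys_inner[of p k m] by (auto simp: facet_poly_def)
qed

text \<open>The residual \<open>r\<close>, replaced by zero on the facets of \<open>\<Gamma>\<close>, is an admissible test function. It yields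
  nothing on the facets of \<open>\<Gamma>\<close>, where test functions vanish.\<close>

lemma facet_orthogonal_zero:
  assumes M: "simplicial_mesh M S"
    and r: "\<And>F. F \<in> facets M \<Longrightarrow> facet_poly k F (r F)"
    and orth: "\<And>q. q \<in> Qbar0 k M \<Gamma> \<Longrightarrow> facet_integral (facets M) (\<lambda>F x. q F x * r F x) = 0"
    and F: "F \<in> facets M" "F \<notin> facets_on M \<Gamma>" "x \<in> F"
  shows "r F x = 0"
proof -
  define q where "q F x = (if F \<in> facets_on M \<Gamma> then 0 else r F x)" for F x
  have q: "facet_poly k F (q F)" if "F \<in> facets M" for F
  proof -
    have "q F = (if F \<in> facets_on M \<Gamma> then (\<lambda>x. 0) else r F)" by (auto simp: q_def)
    then show ?thesis
      using r[OF that] facet_poly_of_poly[OF polys_zero] by (cases "F \<in> facets_on M \<Gamma>") simp_all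
  qed
  have "q \<in> Qbar0 k M \<Gamma>"
    using q by (auto simp: Qbar0_def Qbar_def facet_poly_def q_def)
  moreover have "(\<lambda>F x. q F x * r F x) = (\<lambda>F x. q F x * q F x)" by (auto simp: q_def fun_eq_iff)
  ultimately have "facet_integral (facets M) (\<lambda>F x. q F x * q F x) = 0" using orth[of q] by simp
  then have "q F x = 0"
    using facet_integral_square_zero[where f = q, OF M _ _ F(1,3)] q facet_poly_continuous
    by blast
  then show ?thesis using F(2) by (simp add: q_def)
qed

section \<open>Equations obtained from special test functions\<close>

definition zero_fields :: "('n::finite) hdg_fields" where
  "zero_fields = \<lparr>vel = \<lambda>K x. 0, vel_bar = \<lambda>j F x. 0, pres = \<lambda>K x. 0, pres_bar = \<lambda>j F x. 0,
     darcy = \<lambda>K x. 0, pore = \<lambda>K x. 0, pore_bar = \<lambda>F x. 0\<rparr>"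

lemma vpolys_zero: "(\<lambda>x. 0) \<in> vpolys k"
  by (simp add: vpolys_def polys_zero)

lemma zero_in_spaces:
  "(\<lambda>K x. 0) \<in> Vh k M" "(\<lambda>K x. 0) \<in> Qh k M" "(\<lambda>F x. 0) \<in> Vbar k M \<Gamma>"
  "(\<lambda>F x. 0) \<in> Qbar k M" "(\<lambda>F x. 0) \<in> Qbar0 k M \<Gamma>"
  unfolding Vh_def Qh_def Vbar_def Qbar_def Qbar0_def
  by (intro CollectI ballI conjI vpolys_zero polys_zero bexI[of _ "\<lambda>x. 0"] refl)+

lemma forms_zero:
  "b_form M ((\<lambda>K x. 0), (\<lambda>F x. 0)) v = 0" "c_form M lam \<alpha> w (\<lambda>K x. 0) = 0"
  "bI_form \<F> nrm (\<lambda>F x. 0) vv = 0" "elem_integral M (\<lambda>K x. 0) = 0"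
  by (simp_all add: b_form_def c_form_def bI_form_def elem_integral_def bdry_integral_def
      facet_integral_def set_lebesgue_integral_def split_beta)

lemma b_form_pair:
  "b_form M (q, qb) (v, vb) = - elem_integral M (\<lambda>K x. q K x * divergence (v K) x)
     + bdry_integral M (\<lambda>K F x. qb F x * ((v K x - vb F x) \<bullet> outward_normal K F))"
  by (simp add: b_form_def)

lemma b_form_element: "b_form M (q, (\<lambda>F x. 0)) (v, vb) = - elem_integral M (\<lambda>K x. q K x * divergence (v K) x)"
  by (simp add: b_form_pair bdry_integral_def set_lebesgue_integral_def)

lemma b_form_facet: "b_form M ((\<lambda>K x. 0), qb) (v, vb) =
    bdry_integral M (\<lambda>K F x. qb F x * ((v K x - vb F x) \<bullet> outward_normal K F))"
  by (simp add: b_form_pair forms_zero)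

context
  fixes sub :: "side \<Rightarrow> (real^'n) set" and \<Gamma>D \<Gamma>P \<T> k \<mu> \<beta> lam \<kappa> \<gamma> \<alpha> c\<^sub>0 \<Delta>t f g X0 X
  assumes step: "hdg_step sub \<Gamma>D \<Gamma>P \<T> k \<mu> \<beta> lam \<kappa> \<gamma> \<alpha> c\<^sub>0 \<Delta>t f g X0 X"
begin

lemma step_fields: "X \<in> Xh k \<T> \<Gamma>D \<Gamma>P"
  using step by (simp add: hdg_step_def Let_def)

lemma step_mass_equation:
  assumes "q \<in> Qh k (\<T> Stokes \<union> \<T> Biot)" "\<And>j. qb j \<in> Qbar k (\<T> j)"
  shows "b_form (\<T> Stokes) (q, qb Stokes) (vel X, vel_bar X Stokes)
    + b_form (\<T> Biot) (q, qb Biot) (vel X, vel_bar X Biot)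
    + c_form (\<T> Biot) lam \<alpha> (pore X, pres X) q = 0"
proof -
  let ?Y = "zero_fields\<lparr>pres := q, pres_bar := qb\<rparr>"
  have "?Y \<in> Xh k \<T> \<Gamma>D \<Gamma>P"
    using assms by (simp add: Xh_def zero_fields_def zero_in_spaces)
  with step show ?thesis
    unfolding hdg_step_def Let_def
    by (elim conjE) (drule bspec[where x = ?Y], assumption, simp add: zero_fields_def)
qed

lemma step_pore_equation:
  assumes "q \<in> Qh k (\<T> Biot)" "qb \<in> Qbar0 k (\<T> Biot) \<Gamma>P"
  shows "elem_integral (\<T> Biot) (\<lambda>K x. c\<^sub>0 * time_diff \<Delta>t (pore X) (pore X0) K x * q K x)
    + c_form (\<T> Biot) lam \<alpha>
        (time_diff \<Delta>t (pore X) (pore X0), time_diff \<Delta>t (pres X) (pres X0)) (\<lambda>K x. \<alpha> * q K x)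
    - b_form (\<T> Biot) (q, qb) (darcy X, (\<lambda>F x. 0))
    - bI_form (interface_facets sub \<T>) (interface_normal \<T>) qb
        (vel_bar X Stokes, time_diff \<Delta>t (vel_bar X Biot) (vel_bar X0 Biot))
    = elem_integral (\<T> Biot) (\<lambda>K x. g x * q K x)"
proof -
  let ?Y = "zero_fields\<lparr>pore := q, pore_bar := qb\<rparr>"
  have "?Y \<in> Xh k \<T> \<Gamma>D \<Gamma>P"
    using assms by (simp add: Xh_def zero_fields_def zero_in_spaces)
  with step show ?thesis
    unfolding hdg_step_def Let_def
    by (elim conjE) (drule bspec[where x = ?Y], assumption, simp add: zero_fields_def)
qed

end

section \<open>The interface\<close>

context hdg_setting
begin

lemma mesh_union: "\<Union>(\<T> j) = closure (sub j)"
  using mesh[of j] by (simp add: simplicial_mesh_def)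

lemma element_interior:
  assumes "K \<in> \<T> j"
  shows "interior K \<subseteq> sub j"
proof -
  have "K \<subseteq> closure (sub j)" using assms mesh_union by blast
  then have "interior K \<subseteq> interior (closure (sub j))" by (rule interior_mono)
  then show ?thesis by (simp only: polyhedral_open_interior_closure[OF subdomain])
qed

lemma side_cases: "j = Stokes \<or> j = Biot"
  by (cases j) auto

lemma meshes_disjoint:
  assumes "K \<in> \<T> Stokes"
  shows "K \<notin> \<T> Biot"
proof
  assume "K \<in> \<T> Biot"
  then have "interior K \<subseteq> sub Stokes \<inter> sub Biot" using assms element_interior by blast
  then show False using decomposition(1) mesh_element(4)[OF mesh assms] by simp
qed

text \<open>The interface is contained in both closed subdomains, so an interface facet of one mesh meets an
  element of the other, of which it is a facet because the meshes match.\<close>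

lemma interface_facet_sides:
  assumes F: "F \<in> interface_facets sub \<T>"
  shows "F \<in> facets (\<T> j)" "rel_interior F \<subseteq> frontier (sub j)"
proof -
  have fr: "rel_interior F \<subseteq> frontier (sub j)" for j
    using F side_cases[of j] by (auto simp: interface_facets_def facets_on_iff interface_def)
  then show "rel_interior F \<subseteq> frontier (sub j)" .
  have other: "F \<in> facets (\<T> l)" if i: "F \<in> facets (\<T> i)" "i \<noteq> l" for i l
  proof -
    obtain K where K: "K \<in> \<T> i" "F facet_of K" using i(1) by (elim facetsE)
    obtain y0 where y0: "y0 \<in> rel_interior F" using mesh_facet(3)[OF mesh i(1)] by blast
    then have "y0 \<in> closure (sub l)" using fr[of l] by (auto simp: frontier_def)
    then obtain K' where K': "K' \<in> \<T> l" "y0 \<in> K'" using mesh_union[of l] by blast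
    have mem: "K \<in> \<T> Stokes \<union> \<T> Biot" "K' \<in> \<T> Stokes \<union> \<T> Biot"
      using K K' side_cases[of i] side_cases[of l] by auto
    have "K \<noteq> K'"
      using K K' i(2) meshes_disjoint side_cases[of i] side_cases[of l] by metis
    then have "F facet_of K'"
      using facet_of_other_element[OF matching mem] mesh_element(4)[OF mesh K(1)]
        mesh_element(4)[OF mesh K'(1)] K(2) y0 K'(2) by blast
    then show ?thesis using K'(1) by (auto simp: facets_def)
  qed
  have "F \<in> facets (\<T> Stokes) \<or> F \<in> facets (\<T> Biot)"
    using F by (auto simp: interface_facets_def facets_on_iff facets_def)
  then show "F \<in> facets (\<T> j)" using other by (metis side_cases)
qed

lemma interface_element:
  assumes "F \<in> interface_facets sub \<T>"
  shows "{K \<in> \<T> j. F facet_of K} = {bdry_element (\<T> j) F}"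
proof -
  obtain K where "{L \<in> \<T> j. F facet_of L} = {K}" "bdry_element (\<T> j) F = K"
    using boundary_facet_element[OF mesh subdomain interface_facet_sides[OF assms]] by blast
  then show ?thesis by simp
qed

lemma interface_element_pair:
  assumes F: "F \<in> interface_facets sub \<T>"
  shows "bdry_normal (\<T> Biot) F = - interface_normal \<T> F" and "rel_interior F \<subseteq> \<Omega>"
proof -
  let ?S = "bdry_element (\<T> Stokes) F" and ?B = "bdry_element (\<T> Biot) F"
  have S: "?S \<in> \<T> Stokes" "F facet_of ?S" and B: "?B \<in> \<T> Biot" "F facet_of ?B"
    using interface_element[OF F, of Stokes] interface_element[OF F, of Biot] by blast+
  have "?S \<noteq> ?B" using S(1) B(1) meshes_disjoint by metis
  then have *: "outward_normal ?B F = - outward_normal ?S F" "rel_interior F \<subseteq> interior (?S \<union> ?B)"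
    using two_elements_at_facet[OF matching _ _ _ mesh_element(4)[OF mesh S(1)]
        mesh_element(4)[OF mesh B(1)] S(2) B(2)] S(1) B(1) by auto
  show "bdry_normal (\<T> Biot) F = - interface_normal \<T> F"
    using *(1) by (simp add: bdry_normal_def interface_normal_def)
  have "?S \<union> ?B \<subseteq> closure \<Omega>" using S(1) B(1) mesh_union decomposition(2) by blast
  then have "interior (?S \<union> ?B) \<subseteq> \<Omega>"
    using interior_mono polyhedral_open_interior_closure[OF domain(1)] by blast
  then show "rel_interior F \<subseteq> \<Omega>" using *(2) by blast
qed

text \<open>The two elements at an interface facet surround its relative interior inside \<open>\<Omega>\<close>.\<close>

lemma interface_not_outer:
  assumes F: "F \<in> interface_facets sub \<T>" and G: "\<Gamma> \<subseteq> frontier \<Omega>"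
  shows "F \<notin> facets_on (\<T> j) \<Gamma>"
  using interface_element_pair(2)[OF F] G polyhedral_open_frontier[OF domain(1)]
    mesh_facet(3)[OF mesh interface_facet_sides(1)[OF F, of j]]
  unfolding facets_on_iff by blast

lemma interior_not_boundary:
  assumes F: "F \<in> facets_on (\<T> j) (sub j)" and G: "\<Gamma> \<subseteq> frontier (sub j)"
  shows "\<not> rel_interior F \<subseteq> \<Gamma>"
  using F G polyhedral_open_frontier[OF subdomain[of j]] mesh_facet(3)[OF mesh, of F j]
  unfolding facets_on_iff by blast

lemma boundary_part_element:
  assumes "F \<in> facets_on (\<T> j) \<Gamma>" "\<Gamma> \<subseteq> frontier (sub j)"
  shows "{K \<in> \<T> j. F facet_of K} = {bdry_element (\<T> j) F}"
proof -
  have "F \<in> facets (\<T> j)" "rel_interior F \<subseteq> frontier (sub j)"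
    using assms by (auto simp: facets_on_iff)
  then show ?thesis using boundary_facet_element[OF mesh subdomain] by (metis (lifting))
qed

end

section \<open>Conservation properties of the method\<close>

text \<open>The mass equation is tested with facet pressures of one side. After collecting the contributions of
  the elements at each facet, the sum of the normal components of \<open>u\<^sub>h - ubar\<^sub>h\<close> over these elements is
  orthogonal to all facet polynomials of degree \<open>k\<close>, and is one itself.\<close>

lemma velocity_facet_balance:
  assumes step: "hdg_step sub \<Gamma>D \<Gamma>P \<T> k \<mu> \<beta> lam \<kappa> \<gamma> \<alpha> c\<^sub>0 \<Delta>t f g X0 X"
    and mesh: "\<And>j. simplicial_mesh (\<T> j) (sub j)"
    and F: "F \<in> facets (\<T> j)" "x \<in> F"
  shows "(\<Sum>K | K \<in> \<T> j \<and> F facet_of K. (vel X K x - vel_bar X j F x) \<bullet> outward_normal K F) = 0"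
proof -
  have u: "vel X \<in> Vh k (\<T> i)" and ub: "vel_bar X i \<in> Vbar k (\<T> i) (\<Gamma>D i)" for i
    using step_fields[OF step] by (cases i; auto simp: Xh_def Vh_def)+
  have poly: "facet_poly k F (\<lambda>x. (vel X K x - vel_bar X i F x) \<bullet> outward_normal K F)"
    if "K \<in> \<T> i" "F \<in> facets (\<T> i)" for K F i
    unfolding inner_diff_left
    by (intro facet_poly_diff facet_poly_inner_Vbar[OF ub that(2)] facet_poly_of_poly vpolys_inner)
      (use u that(1) in \<open>simp add: Vh_def\<close>)
  have orth: "facet_integral (facets (\<T> j)) (\<lambda>F x. q F x *
      (\<Sum>K | K \<in> \<T> j \<and> F facet_of K. (vel X K x - vel_bar X j F x) \<bullet> outward_normal K F)) = 0"
    if q: "q \<in> Qbar0 k (\<T> j) {}" for q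
  proof -
    have qQ: "q \<in> Qbar k (\<T> j)" using q by (simp add: Qbar0_def)
    define qb where "qb i = (if i = j then q else (\<lambda>F x. 0))" for i
    have "b_form (\<T> Stokes) ((\<lambda>K x. 0), qb Stokes) (vel X, vel_bar X Stokes)
        + b_form (\<T> Biot) ((\<lambda>K x. 0), qb Biot) (vel X, vel_bar X Biot)
        + c_form (\<T> Biot) lam \<alpha> (pore X, pres X) (\<lambda>K x. 0) = 0"
      by (rule step_mass_equation[OF step zero_in_spaces(2)]) (simp add: qb_def qQ zero_in_spaces)
    then have "b_form (\<T> j) ((\<lambda>K x. 0), q) (vel X, vel_bar X j) = 0"
      by (cases j) (simp_all add: qb_def forms_zero)
    then have "bdry_integral (\<T> j) (\<lambda>K F x. q F x *
        ((vel X K x - vel_bar X j F x) \<bullet> outward_normal K F)) = 0"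
      by (simp only: b_form_facet)
    moreover have "continuous_on F (q F)" if "F \<in> facets (\<T> j)" for F
      by (rule facet_poly_continuous[of k]) (use qQ that in \<open>auto simp: Qbar_def facet_poly_def\<close>)
    moreover have "continuous_on F (\<lambda>x. (vel X K x - vel_bar X j F x) \<bullet> outward_normal K F)"
      if "K \<in> \<T> j" "F facet_of K" for K F
      using poly[OF that(1) facet_geometry(1)[OF mesh that]] by (rule facet_poly_continuous)
    ultimately show ?thesis by (subst (asm) bdry_integral_by_facets[OF mesh])
  qed
  show ?thesis
  proof (rule facet_orthogonal_zero[OF mesh _ orth F(1) _ F(2)])
    show "facet_poly k F (\<lambda>x. \<Sum>K | K \<in> \<T> j \<and> F facet_of K.
        (vel X K x - vel_bar X j F x) \<bullet> outward_normal K F)" if "F \<in> facets (\<T> j)" for F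
      by (rule facet_poly_sum) (use poly that in blast)
    show "F \<notin> facets_on (\<T> j) {}" using mesh_facet(3)[OF mesh F(1)] by (simp add: facets_on_iff)
  qed
qed

text \<open>The facet test functions of the pore pressure see the Darcy flux from the Biot elements and, on
  the interface, also the velocity mismatch through the coupling form. Collected facet by facet,
  the total flux has degree at most \<open>k\<close> and is orthogonal to every facet polynomial that vanishes
  on \<open>\<Gamma>P\<close>.\<close>

lemma darcy_facet_balance:
  assumes step: "hdg_step sub \<Gamma>D \<Gamma>P \<T> k \<mu> \<beta> lam \<kappa> \<gamma> \<alpha> c\<^sub>0 \<Delta>t f g X0 X"
    and X0: "X0 \<in> Xh k \<T> \<Gamma>D \<Gamma>P"
    and mesh: "\<And>j. simplicial_mesh (\<T> j) (sub j)"
    and interface: "\<And>F j. F \<in> interface_facets sub \<T> \<Longrightarrow> F \<in> facets (\<T> j)"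
    and F: "F \<in> facets (\<T> Biot)" "F \<notin> facets_on (\<T> Biot) \<Gamma>P" "x \<in> F"
  shows "(\<Sum>K | K \<in> \<T> Biot \<and> F facet_of K. darcy X K x \<bullet> outward_normal K F)
    + (if F \<in> interface_facets sub \<T> then
        (vel_bar X Stokes F x - time_diff \<Delta>t (vel_bar X Biot) (vel_bar X0 Biot) F x)
          \<bullet> interface_normal \<T> F else 0) = 0"
proof -
  let ?I = "interface_facets sub \<T>"
  define j where "j F x = (vel_bar X Stokes F x - time_diff \<Delta>t (vel_bar X Biot) (vel_bar X0 Biot) F x)
    \<bullet> interface_normal \<T> F" for F x
  define s where "s F x = (\<Sum>K | K \<in> \<T> Biot \<and> F facet_of K. darcy X K x \<bullet> outward_normal K F)" for F x
  define r where "r F x = s F x + (if F \<in> ?I then j F x else 0)" for F x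
  have z: "darcy X \<in> Vh k (\<T> Biot)" using step_fields[OF step] by (simp add: Xh_def)
  have ub: "vel_bar X i \<in> Vbar k (\<T> i) (\<Gamma>D i)" "vel_bar X0 i \<in> Vbar k (\<T> i) (\<Gamma>D i)" for i
    using step_fields[OF step] X0 by (auto simp: Xh_def)
  have zpoly: "(\<lambda>x. darcy X K x \<bullet> m) \<in> polys k" if "K \<in> \<T> Biot" for K m
    using z that by (intro vpolys_inner) (simp add: Vh_def)
  have jpoly: "facet_poly k F (j F)" if "F \<in> ?I" for F
  proof -
    have eq: "j F = (\<lambda>x. vel_bar X Stokes F x \<bullet> interface_normal \<T> F - (1 / \<Delta>t) *
        (vel_bar X Biot F x \<bullet> interface_normal \<T> F - vel_bar X0 Biot F x \<bullet> interface_normal \<T> F))"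
      by (simp add: j_def[abs_def] time_diff_def inner_diff_left)
    show ?thesis
      unfolding eq
      by (intro facet_poly_diff facet_poly_cmult facet_poly_inner_Vbar[OF ub(1)]
          facet_poly_inner_Vbar[OF ub(2)] interface that)
  qed
  have spoly: "facet_poly k F (s F)" for F
    unfolding s_def[abs_def] by (rule facet_poly_sum) (simp add: facet_poly_of_poly zpoly)
  have rpoly: "facet_poly k F (r F)" for F
  proof -
    have "r F = (if F \<in> ?I then (\<lambda>x. s F x + j F x) else s F)" by (auto simp: r_def)
    then show ?thesis using spoly facet_poly_add[OF spoly jpoly] by (cases "F \<in> ?I") simp_all
  qed
  have orth: "facet_integral (facets (\<T> Biot)) (\<lambda>F x. q F x * r F x) = 0"
    if q: "q \<in> Qbar0 k (\<T> Biot) \<Gamma>P" for q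
  proof -
    have qc: "continuous_on F (q F)" if "F \<in> facets (\<T> Biot)" for F
      by (rule facet_poly_continuous[of k]) (use q that in \<open>auto simp: Qbar0_def Qbar_def facet_poly_def\<close>)
    have sub: "?I \<subseteq> facets (\<T> Biot)" using interface by blast
    have "elem_integral (\<T> Biot) (\<lambda>K x. c\<^sub>0 * time_diff \<Delta>t (pore X) (pore X0) K x * 0)
      + c_form (\<T> Biot) lam \<alpha> (time_diff \<Delta>t (pore X) (pore X0), time_diff \<Delta>t (pres X) (pres X0))
          (\<lambda>K x. \<alpha> * 0)
      - b_form (\<T> Biot) ((\<lambda>K x. 0), q) (darcy X, (\<lambda>F x. 0))
      - bI_form ?I (interface_normal \<T>) q
          (vel_bar X Stokes, time_diff \<Delta>t (vel_bar X Biot) (vel_bar X0 Biot))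
      = elem_integral (\<T> Biot) (\<lambda>K x. g x * 0)"
      by (rule step_pore_equation[OF step zero_in_spaces(2) q])
    then have "b_form (\<T> Biot) ((\<lambda>K x. 0), q) (darcy X, (\<lambda>F x. 0))
      + bI_form ?I (interface_normal \<T>) q
          (vel_bar X Stokes, time_diff \<Delta>t (vel_bar X Biot) (vel_bar X0 Biot)) = 0"
      by (simp add: forms_zero)
    moreover have "b_form (\<T> Biot) ((\<lambda>K x. 0), q) (darcy X, (\<lambda>F x. 0)) =
        facet_integral (facets (\<T> Biot)) (\<lambda>F x. q F x * s F x)"
      unfolding b_form_facet s_def diff_zero
      by (rule bdry_integral_by_facets[OF mesh]) (auto intro: qc polys_continuous zpoly)
    moreover have "bI_form ?I (interface_normal \<T>) q
        (vel_bar X Stokes, time_diff \<Delta>t (vel_bar X Biot) (vel_bar X0 Biot)) =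
        (\<Sum>F\<in>?I. LINT x:F|facet_measure F. q F x * j F x)"
      by (simp add: bI_form_def facet_integral_def j_def)
    moreover have "\<dots> = (\<Sum>F\<in>facets (\<T> Biot).
        if F \<in> ?I then LINT x:F|facet_measure F. q F x * j F x else 0)"
      using sub finite_facets[OF mesh] by (simp add: sum.inter_restrict[symmetric] Int_absorb1)
    ultimately have "(\<Sum>F\<in>facets (\<T> Biot). (LINT x:F|facet_measure F. q F x * s F x) +
        (if F \<in> ?I then LINT x:F|facet_measure F. q F x * j F x else 0)) = 0"
      by (simp add: facet_integral_def sum.distrib)
    moreover have "(LINT x:F|facet_measure F. q F x * r F x) =
        (LINT x:F|facet_measure F. q F x * s F x) +
        (if F \<in> ?I then LINT x:F|facet_measure F. q F x * j F x else 0)"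
      if F: "F \<in> facets (\<T> Biot)" for F
    proof (cases "F \<in> ?I")
      case True
      have "(LINT x:F|facet_measure F. q F x * s F x + q F x * j F x) =
          (LINT x:F|facet_measure F. q F x * s F x) + (LINT x:F|facet_measure F. q F x * j F x)"
        by (intro set_integral_add(2) set_integrable_facet mesh_facet(1)[OF mesh F]
            continuous_on_mult qc[OF F] facet_poly_continuous[OF spoly]
            facet_poly_continuous[OF jpoly[OF True]])
      then show ?thesis using True by (simp add: r_def distrib_left)
    qed (simp add: r_def)
    ultimately show ?thesis by (simp add: facet_integral_def)
  qed
  have "r F x = 0"
    by (rule facet_orthogonal_zero[OF mesh rpoly orth F])
  then show ?thesis unfolding r_def s_def j_def .
qed

text \<open>With facet pressures zero the mass equation involves element functions alone. Its test function
  lives on both meshes together; extending a function on one mesh by zero separates the two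
  sides. Each residual has degree at most \<open>k - 1\<close>, so it may be tested with itself.\<close>

lemma velocity_divergence:
  assumes step: "hdg_step sub \<Gamma>D \<Gamma>P \<T> k \<mu> \<beta> lam \<kappa> \<gamma> \<alpha> c\<^sub>0 \<Delta>t f g X0 X"
    and mesh: "\<And>j. simplicial_mesh (\<T> j) (sub j)"
    and disjoint: "\<And>K. K \<in> \<T> Stokes \<Longrightarrow> K \<notin> \<T> Biot"
  shows "\<And>K x. K \<in> \<T> Stokes \<Longrightarrow> x \<in> K \<Longrightarrow> divergence (vel X K) x = 0"
    and "\<And>K x. K \<in> \<T> Biot \<Longrightarrow> x \<in> K \<Longrightarrow>
      divergence (vel X K) x = (1 / lam) * (\<alpha> * pore X K x - pres X K x)"
proof -
  let ?M = "\<T> Stokes \<union> \<T> Biot"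
  have fields: "vel X \<in> Vh k (\<T> Stokes)" "vel X \<in> Vh k (\<T> Biot)"
      "pres X \<in> Qh k (\<T> Biot)" "pore X \<in> Qh k (\<T> Biot)"
    using step_fields[OF step] by (auto simp: Xh_def Vh_def Qh_def)
  note div = Vh_divergence[OF fields(1)] Vh_divergence[OF fields(2)]
  define c where "c K x = (1 / lam) * (\<alpha> * pore X K x - pres X K x)" for K x
  have c: "c \<in> Qh k (\<T> Biot)"
    unfolding c_def[abs_def] by (intro Qh_cmult Qh_diff fields)
  have eq: "- elem_integral (\<T> Stokes) (\<lambda>K x. q K x * divergence (vel X K) x)
      - elem_integral (\<T> Biot) (\<lambda>K x. q K x * divergence (vel X K) x)
      + elem_integral (\<T> Biot) (\<lambda>K x. c K x * q K x) = 0" if "q \<in> Qh k ?M" for q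
    using step_mass_equation[OF step that zero_in_spaces(4)]
    by (simp add: b_form_element c_form_def c_def)
  have cut: "elem_integral (\<T> i) (\<lambda>K x. a K x * (if K \<in> \<T> l then q K x else 0)) = 0"
       "elem_integral (\<T> i) (\<lambda>K x. (if K \<in> \<T> l then q K x else 0) * a K x) = 0"
    if "i \<noteq> l" for i l a q
  proof -
    have "K \<notin> \<T> l" if "K \<in> \<T> i" for K
      using \<open>i \<noteq> l\<close> that disjoint by (cases i; cases l) auto
    then show "elem_integral (\<T> i) (\<lambda>K x. a K x * (if K \<in> \<T> l then q K x else 0)) = 0"
        "elem_integral (\<T> i) (\<lambda>K x. (if K \<in> \<T> l then q K x else 0) * a K x) = 0"
      unfolding elem_integral_def by (simp_all add: set_lebesgue_integral_def)
  qed
  have keep: "elem_integral (\<T> i) (\<lambda>K x. a K x * (if K \<in> \<T> i then q K x else 0)) =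
        elem_integral (\<T> i) (\<lambda>K x. a K x * q K x)"
      "elem_integral (\<T> i) (\<lambda>K x. (if K \<in> \<T> i then q K x else 0) * a K x) =
        elem_integral (\<T> i) (\<lambda>K x. a K x * q K x)" for i a q
    unfolding elem_integral_def by (intro sum.cong refl; simp add: mult.commute)+
  have ext: "(\<lambda>K x. if K \<in> \<T> i then q K x else 0) \<in> Qh k ?M" if "q \<in> Qh k (\<T> i)" for q i
  proof -
    have "(\<lambda>x. if K \<in> \<T> i then q K x else 0) \<in> polys (k - 1)" for K
      using that polys_zero by (cases "K \<in> \<T> i") (simp_all add: Qh_def)
    then show ?thesis by (simp add: Qh_def)
  qed
  show "divergence (vel X K) x = 0" if K: "K \<in> \<T> Stokes" "x \<in> K" for K x
  proof (rule Qh_orthogonal_zero[where r = "\<lambda>K. divergence (vel X K)", OF mesh div(1) _ K])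
    fix q :: "('a, real) broken" assume "q \<in> Qh k (\<T> Stokes)"
    from eq[OF ext[OF this]] show "elem_integral (\<T> Stokes) (\<lambda>K x. divergence (vel X K) x * q K x) = 0"
      by (simp add: cut keep)
  qed
  show "divergence (vel X K) x = (1 / lam) * (\<alpha> * pore X K x - pres X K x)"
    if K: "K \<in> \<T> Biot" "x \<in> K" for K x
  proof -
    have "divergence (vel X K) x - c K x = 0"
    proof (rule Qh_orthogonal_zero[where r = "\<lambda>K x. divergence (vel X K) x - c K x",
          OF mesh Qh_diff[OF div(2) c] _ K])
      fix q :: "('a, real) broken" assume q: "q \<in> Qh k (\<T> Biot)"
      have "elem_integral (\<T> Biot) (\<lambda>K x. (divergence (vel X K) x - c K x) * q K x) =
          elem_integral (\<T> Biot) (\<lambda>K x. divergence (vel X K) x * q K x) -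
          elem_integral (\<T> Biot) (\<lambda>K x. c K x * q K x)"
        unfolding left_diff_distrib
        by (rule elem_integral_diff[OF mesh]; intro continuous_on_mult Qh_continuous[OF div(2)]
            Qh_continuous[OF c] Qh_continuous[OF q])
      also have "\<dots> = 0" using eq[OF ext[OF q]] by (simp add: cut keep)
      finally show "elem_integral (\<T> Biot) (\<lambda>K x. (divergence (vel X K) x - c K x) * q K x) = 0" .
    qed
    then show ?thesis by (simp add: c_def)
  qed
qed

text \<open>With element test functions the pore pressure equation says that \<open>\<nabla> \<cdot> z\<^sub>h\<close> plus the storage terms, a
  function in \<open>Qh\<close>, has the moments of \<open>g\<close>, which makes it the projection of \<open>g\<close>.\<close>

lemma darcy_divergence:
  assumes step: "hdg_step sub \<Gamma>D \<Gamma>P \<T> k \<mu> \<beta> lam \<kappa> \<gamma> \<alpha> c\<^sub>0 \<Delta>t f g X0 X"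
    and X0: "X0 \<in> Xh k \<T> \<Gamma>D \<Gamma>P"
    and mesh: "simplicial_mesh (\<T> Biot) S"
    and K: "K \<in> \<T> Biot" "x \<in> K"
  shows "divergence (darcy X K) x = L2_projection k (\<T> Biot) g K x
    - c\<^sub>0 * time_diff \<Delta>t (pore X) (pore X0) K x
    - \<alpha> * (1 / lam) * (\<alpha> * time_diff \<Delta>t (pore X) (pore X0) K x
        - time_diff \<Delta>t (pres X) (pres X0) K x)"
proof -
  let ?p = "time_diff \<Delta>t (pore X) (pore X0)" and ?r = "time_diff \<Delta>t (pres X) (pres X0)"
  have fields: "darcy X \<in> Vh k (\<T> Biot)" "?p \<in> Qh k (\<T> Biot)" "?r \<in> Qh k (\<T> Biot)"
    using step_fields[OF step] X0 by (auto simp: Xh_def Qh_def[of k "_ \<union> _"] intro!: Qh_time_diff) (auto simp: Qh_def)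
  define a where "a K x = c\<^sub>0 * ?p K x" for K x
  define c where "c K x = \<alpha> * ((1 / lam) * (\<alpha> * ?p K x - ?r K x))" for K x
  define d where "d K = divergence (darcy X K)" for K
  have a: "a \<in> Qh k (\<T> Biot)" unfolding a_def[abs_def] by (intro Qh_cmult fields)
  have c: "c \<in> Qh k (\<T> Biot)" unfolding c_def[abs_def] by (intro Qh_cmult Qh_diff fields)
  have d: "d \<in> Qh k (\<T> Biot)" unfolding d_def[abs_def] by (rule Vh_divergence[OF fields(1)])
  have "L2_projection k (\<T> Biot) g K x = (a K x + c K x) + d K x"
  proof (rule L2_projection_eq[where h = "\<lambda>K x. (a K x + c K x) + d K x",
        OF mesh Qh_add[OF Qh_add[OF a c] d] _ K])
    fix q :: "('a, real) broken" assume q: "q \<in> Qh k (\<T> Biot)"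
    note cont = Qh_continuous[OF a] Qh_continuous[OF c] Qh_continuous[OF d] Qh_continuous[OF q]
    have "elem_integral (\<T> Biot) (\<lambda>K x. ((a K x + c K x) + d K x) * q K x) =
        elem_integral (\<T> Biot) (\<lambda>K x. a K x * q K x + c K x * q K x) +
        elem_integral (\<T> Biot) (\<lambda>K x. d K x * q K x)"
      unfolding distrib_right by (rule elem_integral_add[OF mesh]; intro continuous_on_mult continuous_on_add cont)
    also have "elem_integral (\<T> Biot) (\<lambda>K x. a K x * q K x + c K x * q K x) =
        elem_integral (\<T> Biot) (\<lambda>K x. a K x * q K x) + elem_integral (\<T> Biot) (\<lambda>K x. c K x * q K x)"
      by (rule elem_integral_add[OF mesh]; intro continuous_on_mult cont)
    also have "elem_integral (\<T> Biot) (\<lambda>K x. a K x * q K x) + elem_integral (\<T> Biot) (\<lambda>K x. c K x * q K x)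
        + elem_integral (\<T> Biot) (\<lambda>K x. d K x * q K x) = elem_integral (\<T> Biot) (\<lambda>K x. g x * q K x)"
      using step_pore_equation[OF step q zero_in_spaces(5)]
      by (simp add: forms_zero b_form_element c_form_def a_def c_def d_def mult_ac)
    finally show "elem_integral (\<T> Biot) (\<lambda>K x. ((a K x + c K x) + d K x) * q K x) =
        elem_integral (\<T> Biot) (\<lambda>K x. g x * q K x)" .
  qed
  then show ?thesis by (simp add: a_def c_def d_def)
qed

theorem lemma1:
  fixes \<Omega> :: "(real^'n) set"
    and X :: "nat \<Rightarrow> 'n hdg_fields"
    and n :: nat
  assumes setting:
      "hdg_setting \<Omega> sub \<Gamma>D \<Gamma>N \<Gamma>P \<Gamma>F \<T> \<sigma> k \<mu> \<beta> lam \<kappa> \<gamma> \<alpha> c\<^sub>0 \<Delta>t T N f g"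
    and n: "n < N"
    and initial: "X 0 \<in> Xh k \<T> \<Gamma>D \<Gamma>P"
    and scheme: "\<And>m. m \<le> n \<Longrightarrow>
      hdg_step sub \<Gamma>D \<Gamma>P \<T> k \<mu> \<beta> lam \<kappa> \<gamma> \<alpha> c\<^sub>0 \<Delta>t
        (f (real (m + 1) * \<Delta>t)) (g (real (m + 1) * \<Delta>t)) (X m) (X (m + 1))"
  shows
    "(\<forall>j. \<forall>F \<in> facets_on (\<T> j) (sub j) \<union> facets_on (\<T> j) (\<Gamma>D j). \<forall>x\<in>F.
        jump (\<T> j) (vel (X (n + 1))) F x = 0) \<and>
     (\<forall>j. \<forall>F \<in> facets_on (\<T> j) (\<Gamma>N j). \<forall>x\<in>F.
        bdry_trace (\<T> j) (vel (X (n + 1))) F x \<bullet> bdry_normal (\<T> j) F =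
        vel_bar (X (n + 1)) j F x \<bullet> bdry_normal (\<T> j) F) \<and>
     (\<forall>j. \<forall>F \<in> interface_facets sub \<T>. \<forall>x\<in>F.
        bdry_trace (\<T> j) (vel (X (n + 1))) F x \<bullet> interface_normal \<T> F =
        vel_bar (X (n + 1)) j F x \<bullet> interface_normal \<T> F) \<and>
     (\<forall>F \<in> facets_on (\<T> Biot) (sub Biot) \<union> facets_on (\<T> Biot) \<Gamma>F. \<forall>x\<in>F.
        jump (\<T> Biot) (darcy (X (n + 1))) F x = 0) \<and>
     ((n = 0 \<longrightarrow> (\<forall>F \<in> interface_facets sub \<T>. \<forall>x\<in>F.
        bdry_trace (\<T> Biot) (vel (X 0)) F x \<bullet> interface_normal \<T> F =
        vel_bar (X 0) Biot F x \<bullet> interface_normal \<T> F)) \<longrightarrow>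
     (\<forall>F \<in> interface_facets sub \<T>. \<forall>x\<in>F.
        bdry_trace (\<T> Stokes) (vel (X (n + 1))) F x \<bullet> interface_normal \<T> F =
        (bdry_trace (\<T> Biot) (darcy (X (n + 1))) F x
         + bdry_trace (\<T> Biot) (time_diff \<Delta>t (vel (X (n + 1))) (vel (X n))) F x)
        \<bullet> interface_normal \<T> F)) \<and>
     (\<forall>K \<in> \<T> Stokes. \<forall>x\<in>K. divergence (vel (X (n + 1)) K) x = 0) \<and>
     (\<forall>K \<in> \<T> Biot. \<forall>x\<in>K. divergence (vel (X (n + 1)) K) x =
        (1 / lam) * (\<alpha> * pore (X (n + 1)) K x - pres (X (n + 1)) K x)) \<and>
     (\<forall>K \<in> \<T> Biot. \<forall>x\<in>K. divergence (darcy (X (n + 1)) K) x =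
        L2_projection k (\<T> Biot) (g (real (n + 1) * \<Delta>t)) K x
        - c\<^sub>0 * time_diff \<Delta>t (pore (X (n + 1))) (pore (X n)) K x
        - \<alpha> * (1 / lam) * (\<alpha> * time_diff \<Delta>t (pore (X (n + 1))) (pore (X n)) K x
            - time_diff \<Delta>t (pres (X (n + 1))) (pres (X n)) K x))"
proof -
  interpret hdg_setting \<Omega> sub \<Gamma>D \<Gamma>N \<Gamma>P \<Gamma>F \<T> \<sigma> k \<mu> \<beta> lam \<kappa> \<gamma> \<alpha> c\<^sub>0 \<Delta>t T N f g
    by (rule setting)
  note step = scheme[OF order_refl]
  have Xn: "X n \<in> Xh k \<T> \<Gamma>D \<Gamma>P"
  proof (cases n)
    case (Suc m)
    then show ?thesis using step_fields[OF scheme[of m]] by simp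
  qed (use initial in simp)
  have outer: "\<Gamma>D j \<subseteq> frontier (sub j)" "\<Gamma>N j \<subseteq> frontier (sub j)" for j
    using partition_DN(1)[of j] by auto
  have outerPF: "\<Gamma>P \<subseteq> frontier (sub Biot)" "\<Gamma>F \<subseteq> frontier (sub Biot)"
      "\<Gamma>P \<subseteq> frontier \<Omega>" "\<Gamma>F \<subseteq> frontier \<Omega>" using partition_PF(1) by auto

  have u_element: "bdry_trace (\<T> j) (vel Y) F x \<bullet> bdry_normal (\<T> j) F =
      vel_bar Y j F x \<bullet> bdry_normal (\<T> j) F"
    if "hdg_step sub \<Gamma>D \<Gamma>P \<T> k \<mu> \<beta> lam \<kappa> \<gamma> \<alpha> c\<^sub>0 \<Delta>t f' g' Y0 Y"
      "F \<in> facets (\<T> j)" "x \<in> F" "{K \<in> \<T> j. F facet_of K} = {bdry_element (\<T> j) F}"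
    for Y Y0 f' g' F x j
    using velocity_facet_balance[OF that(1) mesh that(2,3)] that(4)
    by (simp add: bdry_trace_def bdry_normal_def inner_diff_left)
  have u_interface: "bdry_trace (\<T> j) (vel Y) F x \<bullet> interface_normal \<T> F =
      vel_bar Y j F x \<bullet> interface_normal \<T> F"
    if "hdg_step sub \<Gamma>D \<Gamma>P \<T> k \<mu> \<beta> lam \<kappa> \<gamma> \<alpha> c\<^sub>0 \<Delta>t f' g' Y0 Y"
      "F \<in> interface_facets sub \<T>" "x \<in> F"
    for Y Y0 f' g' F x j
    using u_element[OF that(1) interface_facet_sides(1)[OF that(2)] that(3) interface_element[OF that(2)], of j]
      interface_element_pair(1)[OF that(2)]
    by (cases j) (simp_all add: interface_normal_def)

  \<comment> \<open>In the balance of \<open>u - ubar\<close> the facet velocity drops out: inside the domain because it meets two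
    opposite normals, and on the Dirichlet part because it vanishes.\<close>
  have a: "jump (\<T> j) (vel (X (n + 1))) F x = 0"
    if F: "F \<in> facets_on (\<T> j) (sub j) \<union> facets_on (\<T> j) (\<Gamma>D j)" and x: "x \<in> F" for j F x
  proof -
    let ?u = "vel (X (n + 1))" and ?ub = "vel_bar (X (n + 1)) j"
    have Ff: "F \<in> facets (\<T> j)" using F by (auto simp: facets_on_iff)
    have "(\<Sum>K | K \<in> \<T> j \<and> F facet_of K. ?ub F x \<bullet> outward_normal K F) = 0"
    proof (cases "F \<in> facets_on (\<T> j) (sub j)")
      case True
      from interior_facet_elements[OF mesh subdomain True] obtain K K' where
        "{K \<in> \<T> j. F facet_of K} = {K, K'}" "K \<noteq> K'" "outward_normal K' F = - outward_normal K F" .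
      then show ?thesis by simp
    next
      case False
      then have "?ub F x = 0" using F x step_fields[OF step] by (auto simp: Xh_def Vbar_def)
      then show ?thesis by simp
    qed
    then show ?thesis
      using velocity_facet_balance[OF step mesh Ff x]
      by (simp add: jump_def inner_diff_left sum_subtractf)
  qed
  have b: "bdry_trace (\<T> j) (vel (X (n + 1))) F x \<bullet> bdry_normal (\<T> j) F =
        vel_bar (X (n + 1)) j F x \<bullet> bdry_normal (\<T> j) F"
    if "F \<in> facets_on (\<T> j) (\<Gamma>N j)" "x \<in> F" for j F x
    using u_element[OF step _ that(2) boundary_part_element[OF that(1) outer(2)]] that(1)
    by (simp add: facets_on_iff)
  have flux: "(\<Sum>K | K \<in> \<T> Biot \<and> F facet_of K. darcy (X (n + 1)) K x \<bullet> outward_normal K F)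
    + (if F \<in> interface_facets sub \<T> then (vel_bar (X (n + 1)) Stokes F x
        - time_diff \<Delta>t (vel_bar (X (n + 1)) Biot) (vel_bar (X n) Biot) F x)
          \<bullet> interface_normal \<T> F else 0) = 0"
    if "F \<in> facets (\<T> Biot)" "F \<notin> facets_on (\<T> Biot) \<Gamma>P" "x \<in> F" for F x
    by (rule darcy_facet_balance[OF step Xn mesh interface_facet_sides(1) that])
  have c: "jump (\<T> Biot) (darcy (X (n + 1))) F x = 0"
    if F: "F \<in> facets_on (\<T> Biot) (sub Biot) \<union> facets_on (\<T> Biot) \<Gamma>F" and x: "x \<in> F" for F x
  proof -
    have Ff: "F \<in> facets (\<T> Biot)" using F by (auto simp: facets_on_iff)
    have "F \<notin> facets_on (\<T> Biot) \<Gamma>P \<and> F \<notin> interface_facets sub \<T>"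
    proof (cases "F \<in> facets_on (\<T> Biot) (sub Biot)")
      case True
      then show ?thesis
        using interior_not_boundary[OF True outerPF(1)] interior_not_boundary[OF True order_refl]
          interface_facet_sides(2)[of F Biot] by (auto simp: facets_on_iff)
    next
      case False
      then have FF: "F \<in> facets_on (\<T> Biot) \<Gamma>F" using F by blast
      then have "F \<notin> interface_facets sub \<T>" using interface_not_outer[OF _ outerPF(4)] by blast
      moreover have "\<not> rel_interior F \<subseteq> \<Gamma>P"
        using FF partition_PF(2) mesh_facet(3)[OF mesh Ff] unfolding facets_on_iff by blast
      ultimately show ?thesis by (simp add: facets_on_iff)
    qed
    then show ?thesis using flux[OF Ff _ x] by (simp add: jump_def)
  qed
  have d: "bdry_trace (\<T> Stokes) (vel (X (n + 1))) F x \<bullet> interface_normal \<T> F =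
        (bdry_trace (\<T> Biot) (darcy (X (n + 1))) F x
         + bdry_trace (\<T> Biot) (time_diff \<Delta>t (vel (X (n + 1))) (vel (X n))) F x)
        \<bullet> interface_normal \<T> F"
    if init: "n = 0 \<longrightarrow> (\<forall>F \<in> interface_facets sub \<T>. \<forall>x\<in>F.
        bdry_trace (\<T> Biot) (vel (X 0)) F x \<bullet> interface_normal \<T> F =
        vel_bar (X 0) Biot F x \<bullet> interface_normal \<T> F)"
      and F: "F \<in> interface_facets sub \<T>" and x: "x \<in> F" for F x
  proof -
    let ?\<nu> = "interface_normal \<T> F"
    have "(\<Sum>K | K \<in> \<T> Biot \<and> F facet_of K. darcy (X (n + 1)) K x \<bullet> outward_normal K F) =
        - (bdry_trace (\<T> Biot) (darcy (X (n + 1))) F x \<bullet> ?\<nu>)"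
      using interface_element[OF F, of Biot] interface_element_pair(1)[OF F]
      by (simp add: bdry_trace_def bdry_normal_def)
    then have balance: "bdry_trace (\<T> Biot) (darcy (X (n + 1))) F x \<bullet> ?\<nu> =
        (vel_bar (X (n + 1)) Stokes F x
          - time_diff \<Delta>t (vel_bar (X (n + 1)) Biot) (vel_bar (X n) Biot) F x) \<bullet> ?\<nu>"
      using flux[OF interface_facet_sides(1)[OF F] interface_not_outer[OF F outerPF(3)] x] F by simp
    \<comment> \<open>The time difference also involves the previous velocity, whose normal trace agrees with the facet
      velocity by the previous step, or, at the first step, by the assumption on the initial data.\<close>
    have old: "bdry_trace (\<T> Biot) (vel (X n)) F x \<bullet> ?\<nu> = vel_bar (X n) Biot F x \<bullet> ?\<nu>"
    proof (cases n)
      case 0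
      then show ?thesis using init F x by simp
    next
      case (Suc m)
      then show ?thesis using u_interface[OF scheme[of m] F x] by simp
    qed
    have "bdry_trace (\<T> Biot) (time_diff \<Delta>t (vel (X (n + 1))) (vel (X n))) F x \<bullet> ?\<nu> =
        (1 / \<Delta>t) * (bdry_trace (\<T> Biot) (vel (X (n + 1))) F x \<bullet> ?\<nu>
          - bdry_trace (\<T> Biot) (vel (X n)) F x \<bullet> ?\<nu>)"
      by (simp add: bdry_trace_def time_diff_def inner_diff_left)
    also have "\<dots> = time_diff \<Delta>t (vel_bar (X (n + 1)) Biot) (vel_bar (X n) Biot) F x \<bullet> ?\<nu>"
      unfolding old u_interface[OF step F x] by (simp add: time_diff_def inner_diff_left)
    finally show ?thesis
      unfolding u_interface[OF step F x] inner_add_left balance by (simp add: inner_diff_left)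
  qed
  show ?thesis
    by (intro conjI allI ballI impI;
        (rule a | rule b | rule u_interface[OF step] | rule c | rule d
          | rule velocity_divergence[OF step mesh meshes_disjoint]
          | rule darcy_divergence[OF step Xn mesh]); assumption)
qed

end
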